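(* Let $M<N$ and $1\le k\le N$ be positive integers. For each pair partition $\mathfrak{m}\in\mathcal{P}_k$, \begin{align*} \mathrm{Wg}^{\mathbf{A}}(\mathfrak{m})={}&-\frac1N\sum_{i=1}^{2k-2}\mathrm{Wg}^{\mathbf{A}}((i~2k-1)\cdot\mathfrak{m})+\frac MN\,\delta_{\{2k-1,2k\}\in\mathfrak{m}}\,\mathrm{Wg}^{\mathbf{A}}(\mathfrak{m}^\downarrow)\\ &+\frac1N\sum_{i=1}^{2k-2}\delta_{\{i,2k\}\in\mathfrak{m}}\,\mathrm{Wg}^{\mathbf{A}}([(i~2k-1)\cdot\mathfrak{m}]^\downarrow), \end{align*} where $\delta_{\{i,j\}\in\mathfrak{m}}$ is $1$ if $\{i,j\}\in\mathfrak{m}$ and $0$ otherwise.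
   Context: $\mathbf{A}(M,N)$ is the space of $N\times N$ real symmetric idempotent matrices of rank $M$, i.e. $\{OI_{M,N}O^T:O\in\mathrm{O}(N)\}$ with $I_{M,N}=\mathrm{diag}(1,\ldots,1,0,\ldots,0)$ ($M$ ones), with the Haar probability measure $\mathrm{d}\mu$ induced from $\mathrm{O}(N)$; $A_{ij}$ is the $(i,j)$ entry. $\mathcal{P}_k$ is the set of pair partitions of $\{1,\ldots,2k\}$ (partitions into two-element blocks), $\mathcal{P}_0=\{(~)\}$ the empty pair partition. The symmetric group $S_{2k}$ acts on $\mathcal{P}_k$ by $\{a,b\}\in\mathfrak{m}\iff\{\sigma(a),\sigma(b)\}\in\sigma\cdot\mathfrak{m}$. If $\{2k-1,2k\}\in\mathfrak{m}$, $\mathfrak{m}^\downarrow\in\mathcal{P}_{k-1}$ is obtained by deleting this block. A function $i:\{1,\ldots,2k\}\to\{1,\ldots,N\}$ is strongly admissible for $\mathfrak{m}$ if for all $a\neq b$, $\{a,b\}\in\mathfrak{m}\iff i(a)=i(b)$. The Weingarten function is $\mathrm{Wg}^{\mathbf{A}}(\mathfrak{m})=\int_{\mathbf{A}(M,N)}A_{i(1)i(2)}\cdots A_{i(2k-1)i(2k)}\,\mathrm{d}\mu$ for any strongly admissible $i$ (independent of the choice), and $\mathrm{Wg}^{\mathbf{A}}((~))=1$. *)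

theory Defs
  imports "HOL-Probability.Probability"
begin

definition orth_group :: "(real^'n^'n) set" where
  "orth_group = {Q. orthogonal_matrix Q}"

definition haar_O :: "(real^'n^'n) measure" where
  "haar_O = (THE mu. sets mu = sets (restrict_space borel orth_group)
                   \<and> space mu = orth_group
                   \<and> prob_space mu
                   \<and> (\<forall>U\<in>orth_group. distr mu mu (\<lambda>Q. U ** Q) = mu))"

definition I_MN :: "nat \<Rightarrow> ((real, 'n::{finite,linorder}) vec, 'n::{finite,linorder}) vec" where
  "I_MN M = (\<chi> r c. if r = c \<and> card {j. j < r} < M then 1 else 0)"

definition haar_A :: "nat \<Rightarrow> (((real, 'n::{finite,linorder}) vec, 'n::{finite,linorder}) vec) measure" where
  "haar_A M = distr haar_O borel (\<lambda>Q. Q ** I_MN M ** transpose Q)"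

definition pair_partitions :: "nat \<Rightarrow> nat set set set" where
  "pair_partitions k = {m. (\<forall>b\<in>m. card b = 2) \<and> \<Union>m = {1..2*k}
        \<and> (\<forall>b\<in>m. \<forall>b'\<in>m. b \<noteq> b' \<longrightarrow> b \<inter> b' = {})}"

definition perm_act :: "(nat \<Rightarrow> nat) \<Rightarrow> nat set set \<Rightarrow> nat set set" where
  "perm_act \<sigma> m = (\<lambda>b. \<sigma> ` b) ` m"

definition transp_ab :: "nat \<Rightarrow> nat \<Rightarrow> nat \<Rightarrow> nat" where
  "transp_ab a b = (\<lambda>x. if x = a then b else if x = b then a else x)"

definition down :: "nat \<Rightarrow> nat set set \<Rightarrow> nat set set" where
  "down k m = m - {{2*k-1, 2*k}}"

definition strongly_admissible :: "nat \<Rightarrow> nat set set \<Rightarrow> (nat \<Rightarrow> 'n) \<Rightarrow> bool" where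
  "strongly_admissible k m i \<longleftrightarrow>
     (\<forall>a\<in>{1..2*k}. \<forall>b\<in>{1..2*k}. a \<noteq> b \<longrightarrow> ({a,b} \<in> m \<longleftrightarrow> i a = i b))"

definition WgA :: "'n::{finite,linorder} itself \<Rightarrow> nat \<Rightarrow> nat \<Rightarrow> nat set set \<Rightarrow> real" where
  "WgA _ M k m = (if k = 0 then 1 else
     (let i = (SOME i :: nat \<Rightarrow> 'n. strongly_admissible k m i) in
       integral\<^sup>L (haar_A M :: ((real, 'n) vec, 'n) vec measure)
         (\<lambda>A. \<Prod>j<k. A $ i (2*j+1) $ i (2*j+2))))"

end

theory Submission
  imports Defs
begin

text \<open>
  Fix a strongly admissible index function \<open>i\<close>, let \<open>{2k-1, b}\<close> be the block of \<open>2k-1\<close>, and let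
  both indices of this block run through a common value \<open>v\<close>. Summing over \<open>v\<close>, the integrand
  collapses because \<open>tr A = M\<close> (if \<open>b = 2k\<close>) or \<open>A\<^sup>2 = A\<close> (otherwise); this gives the terms of
  order \<open>k - 1\<close>. On the other hand, each single integral is known: if \<open>v\<close> is not used by another block
  it is \<open>Wg(m)\<close>. If \<open>v\<close> is the value on the block \<open>{x, y}\<close>, the index \<open>v\<close> occurs four times, and since
  \<open>k \<le> N\<close> a free index is available; invariance under reflections of the plane of these two
  indices splits the integral into the three pairings \<open>Wg(m) + Wg((x 2k-1) m) + Wg((y 2k-1) m)\<close>.

  The Haar measure on the orthogonal group is defined by a definite description, so its existence
  (Gram-Schmidt applied to a rotation-invariant random matrix) and uniqueness (Fubini) are needed.
\<close>

section \<open>The orthogonal group and uniqueness of its Haar measure\<close>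

lemma orth_group_mult: "U \<in> orth_group \<Longrightarrow> Q \<in> orth_group \<Longrightarrow> U ** Q \<in> orth_group"
  by (simp add: orth_group_def orthogonal_matrix_mul)

lemma orth_group_transpose: "Q \<in> orth_group \<Longrightarrow> transpose Q \<in> orth_group"
  by (simp add: orth_group_def)

lemma continuous_on_matrix_mult [continuous_intros]:
  fixes f g :: "'a::topological_space \<Rightarrow> real^'n^'n"
  assumes "continuous_on S f" "continuous_on S g"
  shows "continuous_on S (\<lambda>x. f x ** g x)"
  unfolding matrix_matrix_mult_def
  by (intro continuous_intros assms)

lemma continuous_on_transpose [continuous_intros]:
  fixes f :: "'a::topological_space \<Rightarrow> real^'n^'n"
  assumes "continuous_on S f"
  shows "continuous_on S (\<lambda>x. transpose (f x))"
  unfolding transpose_def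
  by (intro continuous_intros assms)

lemma borel_measurable_matrix_mult [measurable (raw)]:
  fixes f g :: "'a \<Rightarrow> real^'n^'n"
  assumes "f \<in> borel_measurable M" "g \<in> borel_measurable M"
  shows "(\<lambda>x. f x ** g x) \<in> borel_measurable M"
  by (rule borel_measurable_continuous_Pair[OF assms]) (intro continuous_intros)

lemma borel_measurable_transpose [measurable (raw)]:
  fixes f :: "'a \<Rightarrow> real^'n^'n"
  assumes "f \<in> borel_measurable M"
  shows "(\<lambda>x. transpose (f x)) \<in> borel_measurable M"
  by (rule borel_measurable_continuous_on[OF _ assms]) (intro continuous_intros)

lemma closed_orth_group: "closed (orth_group :: (real^'n^'n) set)"
proof -
  have "(orth_group :: (real^'n^'n) set) = {Q. transpose Q ** Q = mat 1}"
    by (auto simp: orth_group_def orthogonal_matrix)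
  moreover have "closed {Q :: real^'n^'n. transpose Q ** Q = mat 1}"
    by (intro closed_Collect_eq continuous_intros)
  ultimately show ?thesis by simp
qed

text \<open>The rows are unit vectors, which bounds the norm by the number of rows. Compactness
  later makes continuous integrands integrable.\<close>

lemma compact_orth_group: "compact (orth_group :: (real^'n^'n) set)"
proof -
  have "norm Q \<le> real CARD('n)" if "Q \<in> orth_group" for Q :: "real^'n^'n"
  proof -
    have "norm Q \<le> (\<Sum>i\<in>UNIV. norm (Q $ i))"
      unfolding norm_vec_def by (rule L2_set_le_sum) simp
    also have "\<dots> = (\<Sum>i\<in>(UNIV::'n set). 1)"
      using that by (intro sum.cong)
        (auto simp: orth_group_def orthogonal_matrix_orthonormal_rows row_def)
    finally show ?thesis by simp
  qed
  then have "bounded (orth_group :: (real^'n^'n) set)"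
    by (auto simp: bounded_iff)
  with closed_orth_group show ?thesis
    by (simp add: compact_eq_bounded_closed)
qed

section \<open>Left-invariant probability measures and their uniqueness\<close>

definition left_haar :: "(real^'n^'n) measure \<Rightarrow> bool" where
  "left_haar mu \<longleftrightarrow> sets mu = sets (restrict_space borel orth_group)
     \<and> space mu = orth_group \<and> prob_space mu
     \<and> (\<forall>U\<in>orth_group. distr mu mu (\<lambda>Q. U ** Q) = mu)"

lemma haar_O_eq_The: "haar_O = (THE mu. left_haar mu)"
  by (simp add: haar_O_def left_haar_def)

text \<open>The measure carries the trace sigma-algebra on \<open>orth_group\<close>; this lemma and
  the next pass between it and the Borel sets of all matrices.\<close>

lemma left_haar_measurable_into:
  assumes "left_haar mu" "f \<in> borel_measurable M" "\<And>x. x \<in> space M \<Longrightarrow> f x \<in> orth_group"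
  shows "f \<in> measurable M mu"
proof -
  have "f \<in> measurable M (restrict_space borel orth_group)"
    using assms by (intro measurable_restrict_space2) auto
  then show ?thesis
    using assms(1) by (subst measurable_cong_sets[OF refl, of mu]) (auto simp: left_haar_def)
qed

lemma left_haar_ident_borel:
  assumes "left_haar mu"
  shows "(\<lambda>x. x) \<in> borel_measurable mu"
proof -
  have "(\<lambda>x. x) \<in> borel_measurable (restrict_space borel orth_group)"
    by (rule measurable_restrict_space1) simp
  then show ?thesis
    using assms by (subst measurable_cong_sets[of mu, OF _ refl]) (auto simp: left_haar_def)
qed

text \<open>Integrate the indicator of \<open>y\<^sup>T x \<in> A\<close> over both variables: invariance of \<open>mu\<close> in \<open>x\<close>
  gives the left-hand side, invariance of \<open>nu\<close> in \<open>y\<close> the right-hand side.\<close>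

lemma left_haar_emeasure_transpose:
  assumes mu: "left_haar mu" and nu: "left_haar nu" and A: "A \<in> sets mu"
  shows "emeasure mu A = emeasure nu {y \<in> orth_group. transpose y \<in> A}"
proof -
  interpret mu: prob_space mu using mu by (simp add: left_haar_def)
  interpret nu: prob_space nu using nu by (simp add: left_haar_def)
  interpret pair_sigma_finite nu mu ..
  have sp: "space mu = orth_group" "space nu = orth_group"
    using mu nu by (auto simp: left_haar_def)
  note [measurable] = left_haar_ident_borel[OF mu] left_haar_ident_borel[OF nu]
  have f1 [measurable]: "fst \<in> borel_measurable (nu \<Otimes>\<^sub>M mu)"
    using measurable_compose[OF measurable_fst left_haar_ident_borel[OF nu]] by simp
  have f2 [measurable]: "snd \<in> borel_measurable (nu \<Otimes>\<^sub>M mu)"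
    using measurable_compose[OF measurable_snd left_haar_ident_borel[OF mu]] by simp
  have mult: "(\<lambda>p. transpose (fst p) ** snd p) \<in> measurable (nu \<Otimes>\<^sub>M mu) mu"
    by (rule left_haar_measurable_into[OF mu])
      (auto simp: space_pair_measure sp orth_group_mult orth_group_transpose)
  have tr: "transpose \<in> measurable nu mu"
    by (rule left_haar_measurable_into[OF mu]) (auto simp: sp orth_group_transpose)
  \<comment> \<open>Formulated for a general \<open>la\<close> because it serves \<open>mu\<close>
    before the exchange of integrals and \<open>nu\<close> after it.\<close>
  have inv: "emeasure la {x \<in> orth_group. U ** x \<in> B} = emeasure la B"
    if la: "left_haar la" and U: "U \<in> orth_group" and B: "B \<in> sets la" for la U and B :: "(real^'a^'a) set"
  proof -
    have 1: "space la = orth_group" "distr la la (\<lambda>Q. U ** Q) = la" using la U by (auto simp: left_haar_def)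
    note [measurable] = left_haar_ident_borel[OF la]
    have "(\<lambda>Q. U ** Q) \<in> measurable la la"
      by (rule left_haar_measurable_into[OF la]) (auto simp: 1 U orth_group_mult)
    then have "emeasure (distr la la (\<lambda>Q. U ** Q)) B = emeasure la ((\<lambda>Q. U ** Q) -` B \<inter> space la)"
      using B by (rule emeasure_distr)
    also have "(\<lambda>Q. U ** Q) -` B \<inter> space la = {x \<in> orth_group. U ** x \<in> B}"
      using 1 by auto
    finally show ?thesis using 1 by simp
  qed
  have S: "{y \<in> orth_group. transpose y \<in> A} \<in> sets nu"
    using measurable_sets[OF tr A] by (simp add: sp vimage_def Int_def conj_commute)
  have m: "(\<lambda>p. indicator A (transpose (fst p) ** snd p) :: ennreal) \<in> borel_measurable (nu \<Otimes>\<^sub>M mu)"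
    by (rule measurable_compose[OF mult]) (use A in measurable)
  have m1: "(\<lambda>x. transpose y ** x) \<in> measurable mu mu" if "y \<in> orth_group" for y
    by (rule left_haar_measurable_into[OF mu]) (auto simp: sp that orth_group_mult orth_group_transpose)
  have m2: "(\<lambda>y. transpose y ** x) \<in> measurable nu mu" if "x \<in> orth_group" for x
    by (rule left_haar_measurable_into[OF mu]) (auto simp: sp that orth_group_mult orth_group_transpose)
  have "emeasure mu A = (\<integral>\<^sup>+y. emeasure mu A \<partial>nu)"
    by (simp add: nu.emeasure_space_1)
  also have "\<dots> = (\<integral>\<^sup>+y. \<integral>\<^sup>+x. indicator A (transpose y ** x) \<partial>mu \<partial>nu)"
  proof (rule nn_integral_cong)
    fix y assume "y \<in> space nu"
    then have y: "y \<in> orth_group" by (simp add: sp)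
    have "(\<integral>\<^sup>+x. indicator A (transpose y ** x) \<partial>mu) = (\<integral>\<^sup>+x. indicator {x\<in>orth_group. transpose y ** x \<in> A} x \<partial>mu)"
      by (rule nn_integral_cong) (auto simp: sp split: split_indicator)
    also have "\<dots> = emeasure mu {x\<in>orth_group. transpose y ** x \<in> A}"
      using measurable_sets[OF m1[OF y] A]
      by (intro nn_integral_indicator) (simp add: sp vimage_def Int_def conj_commute)
    also have "\<dots> = emeasure mu A"
      by (rule inv[OF mu orth_group_transpose[OF y] A])
    finally show "emeasure mu A = (\<integral>\<^sup>+x. indicator A (transpose y ** x) \<partial>mu)" by simp
  qed
  also have "\<dots> = (\<integral>\<^sup>+x. \<integral>\<^sup>+y. indicator A (transpose y ** x) \<partial>nu \<partial>mu)"
    using Fubini[OF m] by simp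
  also have "\<dots> = (\<integral>\<^sup>+x. emeasure nu {y \<in> orth_group. transpose y \<in> A} \<partial>mu)"
  proof (rule nn_integral_cong)
    fix x assume "x \<in> space mu"
    then have x: "x \<in> orth_group" by (simp add: sp)
    \<comment> \<open>Transposing the product moves \<open>y\<close> to the right of a fixed factor,
      so that left invariance of \<open>nu\<close> applies to the transposed set.\<close>
    have eq: "{y\<in>orth_group. transpose y ** x \<in> A} = {y\<in>orth_group. transpose x ** y \<in> {y \<in> orth_group. transpose y \<in> A}}"
      using x by (auto simp: matrix_transpose_mul orth_group_mult orth_group_transpose)
    have "(\<integral>\<^sup>+y. indicator A (transpose y ** x) \<partial>nu) = (\<integral>\<^sup>+y. indicator {y\<in>orth_group. transpose y ** x \<in> A} y \<partial>nu)"
      by (rule nn_integral_cong) (auto simp: sp split: split_indicator)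
    also have "\<dots> = emeasure nu {y\<in>orth_group. transpose y ** x \<in> A}"
      using measurable_sets[OF m2[OF x] A]
      by (intro nn_integral_indicator) (simp add: sp vimage_def Int_def conj_commute)
    also have "\<dots> = emeasure nu {y \<in> orth_group. transpose y \<in> A}"
      unfolding eq by (rule inv[OF nu orth_group_transpose[OF x] S])
    finally show "(\<integral>\<^sup>+y. indicator A (transpose y ** x) \<partial>nu) = emeasure nu {y \<in> orth_group. transpose y \<in> A}" .
  qed
  also have "\<dots> = emeasure nu {y \<in> orth_group. transpose y \<in> A}"
    by (simp add: mu.emeasure_space_1)
  finally show ?thesis .
qed

text \<open>The transposition formula for \<open>mu\<close>, \<open>nu\<close> and for
  \<open>nu\<close>, \<open>nu\<close> has the same right-hand side.\<close>

lemma left_haar_unique: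
  assumes "left_haar mu" "left_haar nu"
  shows "mu = nu"
proof (rule measure_eqI)
  show "sets mu = sets nu" using assms by (simp add: left_haar_def)
  then show "emeasure mu A = emeasure nu A" if "A \<in> sets mu" for A
    using that left_haar_emeasure_transpose[OF assms(1,2)] left_haar_emeasure_transpose[OF assms(2,2)]
    by simp
qed

section \<open>Existence of the Haar measure\<close>

text \<open>Serves to cancel the volume of the unit ball and to normalise a uniform
  distribution.\<close>

lemma emeasure_lborel_open_nonzero:
  fixes S :: "'a::euclidean_space set"
  assumes "open S" "S \<noteq> {}"
  shows "emeasure lborel S \<noteq> 0"
proof
  assume "emeasure lborel S = 0"
  then have "S \<in> null_sets (completion lborel)"
    using assms(1) by (intro null_sets_completionI) auto
  then show False
    using open_not_negligible[OF assms] by (simp add: negligible_iff_null_sets)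
qed

text \<open>Uniqueness of translation-invariant measures, in the following form: with \<open>B\<close> the unit ball,
  integrating the indicator of \<open>f x \<in> A \<and> y - f x \<in> B\<close> in the two possible orders gives
  \<open>\<lambda>(f\<^sup>-\<^sup>1 A) \<lambda>(B)\<close> and \<open>\<lambda>(A) \<lambda>(B)\<close>.\<close>

lemma emeasure_lborel_orthogonal_vimage:
  fixes f :: "'a::euclidean_space \<Rightarrow> 'a"
  assumes f: "orthogonal_transformation f" and A: "A \<in> sets borel"
  shows "emeasure lborel (f -` A) = emeasure lborel A"
proof -
  define B where "B = ball (0::'a) 1"
  obtain g where g: "\<And>y. f (g y) = y"
    using orthogonal_transformation_surj[OF f] by (metis surj_def)
  have lin: "linear f" using f by (rule orthogonal_transformation_linear)
  have nf: "norm (f x) = norm x" for x using f by (rule orthogonal_transformation_norm)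
  have [measurable]: "f \<in> borel_measurable borel"
    using lin by (intro borel_measurable_continuous_onI linear_continuous_on)
      (simp add: linear_conv_bounded_linear)
  have [measurable]: "A \<in> sets borel" by fact
  have Bm [measurable]: "B \<in> sets borel" by (simp add: B_def)
  have shift: "(\<integral>\<^sup>+x. h (c + x) \<partial>lborel) = (\<integral>\<^sup>+x. h x \<partial>lborel)"
    if [measurable]: "h \<in> borel_measurable borel" for h :: "'a \<Rightarrow> ennreal" and c
    by (subst (2) lborel_distr_plus[of c, symmetric]) (simp add: nn_integral_distr)
  have fA: "f -` A \<in> sets borel"
    using measurable_sets[of f borel borel A] by simp
  have shB: "(\<integral>\<^sup>+y. indicator B (y - z) \<partial>lborel) = emeasure lborel B" for z
    using shift[of "\<lambda>y. indicator B y" "-z"] by simp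
  have shA: "(\<integral>\<^sup>+y. indicator A (z + y) \<partial>lborel) = emeasure lborel A" for z
    using shift[of "\<lambda>y. indicator A y" z] by simp
  have m: "(\<lambda>p. indicator A (f (fst p)) * indicator B (snd p - f (fst p)) :: ennreal) \<in> borel_measurable (lborel \<Otimes>\<^sub>M lborel)"
    by measurable
  have m': "(\<lambda>p. indicator A (f (fst p) + snd p) * indicator B (- f (fst p)) :: ennreal) \<in> borel_measurable (lborel \<Otimes>\<^sub>M lborel)"
    by measurable
  have "emeasure lborel (f -` A) * emeasure lborel B
      = (\<integral>\<^sup>+x. indicator (f -` A) x * emeasure lborel B \<partial>lborel)"
    using fA by (simp add: nn_integral_multc)
  also have "\<dots> = (\<integral>\<^sup>+x. \<integral>\<^sup>+y. indicator A (f x) * indicator B (y - f x) \<partial>lborel \<partial>lborel)"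
    by (intro nn_integral_cong) (simp add: nn_integral_cmult shB indicator_vimage)
  also have "\<dots> = (\<integral>\<^sup>+y. \<integral>\<^sup>+x. indicator A (f x) * indicator B (y - f x) \<partial>lborel \<partial>lborel)"
    using lborel_pair.Fubini[OF m] by simp
  \<comment> \<open>Translate \<open>x\<close> by \<open>g y\<close>: as \<open>f\<close> is linear
    and \<open>f (g y) = y\<close>, this turns \<open>f x\<close> into \<open>f x + y\<close> and
    \<open>y - f x\<close> into \<open>- f x\<close>.\<close>
  also have "\<dots> = (\<integral>\<^sup>+y. \<integral>\<^sup>+x. indicator A (f x + y) * indicator B (- f x) \<partial>lborel \<partial>lborel)"
  proof (rule nn_integral_cong)
    fix y
    show "(\<integral>\<^sup>+x. indicator A (f x) * indicator B (y - f x) \<partial>lborel)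
        = (\<integral>\<^sup>+x. indicator A (f x + y) * indicator B (- f x) \<partial>lborel)"
      using shift[of "\<lambda>x. indicator A (f x) * indicator B (y - f x)" "g y"]
      by (simp add: linear_add[OF lin] g add.commute)
  qed
  also have "\<dots> = (\<integral>\<^sup>+x. \<integral>\<^sup>+y. indicator A (f x + y) * indicator B (- f x) \<partial>lborel \<partial>lborel)"
    using lborel_pair.Fubini[OF m'] by simp
  \<comment> \<open>The integral over \<open>y\<close> is the volume of \<open>A\<close>; since
    \<open>f\<close> preserves norms, \<open>- f x\<close> lies in the ball iff \<open>x\<close>
    does.\<close>
  also have "\<dots> = (\<integral>\<^sup>+x. emeasure lborel A * indicator B x \<partial>lborel)"
    by (intro nn_integral_cong) (simp add: nn_integral_multc shA, simp add: B_def nf indicator_def)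
  also have "\<dots> = emeasure lborel A * emeasure lborel B"
    by (simp add: nn_integral_cmult)
  finally have eq: "emeasure lborel (f -` A) * emeasure lborel B = emeasure lborel A * emeasure lborel B" .
  have "emeasure lborel B \<noteq> 0"
    unfolding B_def by (rule emeasure_lborel_open_nonzero) auto
  moreover have "emeasure lborel B \<noteq> \<infinity>"
    using emeasure_lborel_ball_finite[of "0::'a" 1] by (simp add: B_def)
  ultimately show ?thesis
    using eq by (metis ennreal_mult_divide_eq infinity_ennreal_def)
qed

section \<open>The Gram-Schmidt process\<close>

text \<open>\<open>sgn\<close> divides by the norm; as \<open>sgn 0 = 0\<close>, a vanishing
  remainder yields the zero vector and the recursion is total.\<close>

fun gram_schmidt :: "(nat \<Rightarrow> 'a::real_inner) \<Rightarrow> nat \<Rightarrow> 'a" where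
  "gram_schmidt x k = sgn (x k - (\<Sum>l<k. (x k \<bullet> gram_schmidt x l) *\<^sub>R gram_schmidt x l))"

declare gram_schmidt.simps [simp del]

text \<open>Places the sum subtracted at stage \<open>k\<close> in the span of the earlier inputs,
  so that it cannot cancel an \<open>x k\<close> outside that span.\<close>

lemma gram_schmidt_in_span: "gram_schmidt x k \<in> span (x ` {..k})"
proof (induction k rule: less_induct)
  case (less k)
  have "gram_schmidt x l \<in> span (x ` {..k})" if "l < k" for l
    using less[OF that] span_mono[of "x ` {..l}" "x ` {..k}"] that by force
  then have "x k - (\<Sum>l<k. (x k \<bullet> gram_schmidt x l) *\<^sub>R gram_schmidt x l) \<in> span (x ` {..k})"
    by (intro span_diff span_sum span_mul) (auto intro: span_base)
  then show ?case
    by (subst gram_schmidt.simps) (simp only: sgn_div_norm span_mul)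
qed

lemma gram_schmidt_orthonormal:
  assumes "\<And>j. j < n \<Longrightarrow> x j \<notin> span (x ` {..<j})" and "k < n"
  shows "norm (gram_schmidt x k) = 1 \<and> (\<forall>l<k. gram_schmidt x l \<bullet> gram_schmidt x k = 0)"
  using \<open>k < n\<close>
proof (induction k rule: less_induct)
  case (less k)
  let ?g = "gram_schmidt x"
  define r where "r = x k - (\<Sum>l<k. (x k \<bullet> ?g l) *\<^sub>R ?g l)"
  have gk: "?g k = sgn r" unfolding r_def by (rule gram_schmidt.simps)
  have "?g l \<in> span (x ` {..<k})" if "l < k" for l
    using gram_schmidt_in_span[of x l] span_mono[of "x ` {..l}" "x ` {..<k}"] that by force
  then have "(\<Sum>l<k. (x k \<bullet> ?g l) *\<^sub>R ?g l) \<in> span (x ` {..<k})"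
    by (intro span_sum span_mul) auto
  then have "r \<noteq> 0" using assms(1)[OF less.prems] by (auto simp: r_def)
  then have "norm (?g k) = 1" by (simp add: gk norm_sgn)
  moreover have "?g l \<bullet> ?g k = 0" if l: "l < k" for l
  proof -
    have orth: "?g l \<bullet> ?g j = (if j = l then 1 else 0)" if "j < k" for j
    proof (cases j l rule: linorder_cases)
      case less
      then show ?thesis using less.IH[of l] l less.prems by (auto simp: inner_commute)
    next
      case equal
      then show ?thesis using less.IH[of l] l less.prems by (simp add: norm_eq_1)
    next
      case greater
      then show ?thesis using less.IH[of j] that less.prems by auto
    qed
    have "?g l \<bullet> r = ?g l \<bullet> x k - (\<Sum>j<k. (x k \<bullet> ?g j) * (?g l \<bullet> ?g j))"
      by (simp add: r_def inner_diff_right inner_sum_right)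
    also have "(\<Sum>j<k. (x k \<bullet> ?g j) * (?g l \<bullet> ?g j)) = (\<Sum>j<k. if j = l then x k \<bullet> ?g l else 0)"
      by (intro sum.cong) (auto simp: orth)
    also have "\<dots> = x k \<bullet> ?g l" using l by simp
    finally show ?thesis by (simp add: gk sgn_div_norm inner_commute)
  qed
  ultimately show ?case by blast
qed

text \<open>The recursion is built from inner products, norms and linear combinations, all of which
  \<open>f\<close> respects.\<close>

lemma gram_schmidt_equivariant:
  assumes f: "orthogonal_transformation f"
  shows "gram_schmidt (\<lambda>k. f (x k)) k = f (gram_schmidt x k)"
proof (induction k rule: less_induct)
  case (less k)
  have lin: "linear f" using f by (rule orthogonal_transformation_linear)
  have in_f: "f u \<bullet> f v = u \<bullet> v" for u v
    using f by (simp add: orthogonal_transformation_def)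
  have nf: "norm (f u) = norm u" for u using f by (rule orthogonal_transformation_norm)
  have "(\<Sum>l<k. (f (x k) \<bullet> gram_schmidt (\<lambda>k. f (x k)) l) *\<^sub>R gram_schmidt (\<lambda>k. f (x k)) l)
      = (\<Sum>l<k. f ((x k \<bullet> gram_schmidt x l) *\<^sub>R gram_schmidt x l))"
    by (intro sum.cong) (auto simp: less in_f linear_cmul[OF lin])
  then have "f (x k) - (\<Sum>l<k. (f (x k) \<bullet> gram_schmidt (\<lambda>k. f (x k)) l) *\<^sub>R gram_schmidt (\<lambda>k. f (x k)) l)
      = f (x k - (\<Sum>l<k. (x k \<bullet> gram_schmidt x l) *\<^sub>R gram_schmidt x l))"
    by (simp only: linear_diff[OF lin] linear_sum[OF lin])
  then show ?case
    by (subst (1 2) gram_schmidt.simps) (simp only: sgn_div_norm linear_cmul[OF lin] nf)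
qed

lemma borel_measurable_gram_schmidt:
  fixes x :: "'b \<Rightarrow> nat \<Rightarrow> 'a::euclidean_space"
  assumes "\<And>k. (\<lambda>w. x w k) \<in> borel_measurable M"
  shows "(\<lambda>w. gram_schmidt (x w) k) \<in> borel_measurable M"
proof (induction k rule: less_induct)
  case (less k)
  note [measurable] = assms
  have [measurable]: "(\<lambda>w. \<Sum>l<k. (x w k \<bullet> gram_schmidt (x w) l) *\<^sub>R gram_schmidt (x w) l) \<in> borel_measurable M"
    by (intro borel_measurable_sum borel_measurable_scaleR borel_measurable_inner less assms) auto
  show ?case
    by (subst gram_schmidt.simps) (simp add: sgn_div_norm, measurable)
qed

section \<open>Gram-Schmidt on the columns of a matrix\<close>

lemma column_matrix_mult:
  fixes A B :: "real^'n^'n"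
  shows "column c (A ** B) = A *v column c B"
  by (simp add: vec_eq_iff column_def matrix_matrix_mult_def matrix_vector_mult_def)

lemma inner_matrix_columns:
  fixes X Y :: "real^'n^'n"
  shows "X \<bullet> Y = (\<Sum>c\<in>UNIV. column c X \<bullet> column c Y)"
  unfolding inner_vec_def column_def by simp (rule sum.swap)

lemma orthogonal_transformation_matrix_vector_mult:
  fixes U :: "real^'n^'n"
  assumes "U \<in> orth_group"
  shows "orthogonal_transformation (\<lambda>v. U *v v)"
  using assms by (simp add: orth_group_def orthogonal_transformation_matrix)

text \<open>The inner product of matrices is a sum over columns, and \<open>U\<close> acts on each
  column as an isometry.\<close>

lemma orthogonal_transformation_matrix_mult:
  fixes U :: "real^'n^'n"
  assumes "U \<in> orth_group"
  shows "orthogonal_transformation (\<lambda>X::real^'n^'n. U ** X)"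
proof -
  have "linear (\<lambda>X::real^'n^'n. U ** X)"
    by (rule linearI) (simp_all add: matrix_add_ldistrib matrix_scalar_ac scalar_matrix_assoc
      vec_eq_iff matrix_matrix_mult_def sum_distrib_left algebra_simps sum.distrib)
  with orthogonal_transformation_matrix_vector_mult[OF assms] show ?thesis
    by (simp add: orthogonal_transformation_def inner_matrix_columns column_matrix_mult)
qed

text \<open>Adding to a row of the transpose a combination of the other rows leaves the determinant
  unchanged; here the row could be made zero.\<close>

lemma column_not_in_span:
  fixes X :: "real^'n^'n"
  assumes "det X \<noteq> 0"
  shows "column c X \<notin> span {column j X |j. j \<noteq> c}"
proof
  let ?A = "transpose X"
  assume "column c X \<in> span {column j X |j. j \<noteq> c}"
  then have "- row c ?A \<in> vec.span {row j ?A |j. j \<noteq> c}"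
    by (auto simp: span_vec_eq intro: span_neg)
  from det_row_span[OF this]
  have "det ?A = det (\<chi> k. if k = c then 0 else row k ?A)" by (simp cong: if_cong)
  also have "\<dots> = 0"
    by (rule det_zero_row(2)[of c]) (simp add: row_def vec_eq_iff)
  finally show False using assms by simp
qed

text \<open>The index type is merely finite, so an enumeration \<open>f\<close> prescribes the order
  in which the columns are processed; \<open>inv_into\<close> gives the position of \<open>c\<close>
  in it.\<close>

definition gs_matrix :: "(nat \<Rightarrow> 'n) \<Rightarrow> real^'n^'n \<Rightarrow> real^'n^'n" where
  "gs_matrix f X = (\<chi> r c. gram_schmidt (\<lambda>k. column (f k) X) (inv_into {..<CARD('n)} f c) $ r)"

lemma column_gs_matrix:
  "column c (gs_matrix f X) =
    gram_schmidt (\<lambda>k. column (f k) X) (inv_into {..<CARD('n)} f c)" for X :: "real^'n^'n"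
  by (simp add: gs_matrix_def column_def)

lemma matrix_eq_columns:
  fixes X Y :: "real^'n^'n"
  shows "X = Y \<longleftrightarrow> (\<forall>c. column c X = column c Y)"
  by (auto simp: column_def vec_eq_iff)

lemma gs_matrix_equivariant:
  fixes U X :: "real^'n^'n"
  assumes "U \<in> orth_group"
  shows "gs_matrix f (U ** X) = U ** gs_matrix f X"
  by (simp add: matrix_eq_columns column_gs_matrix column_matrix_mult
      gram_schmidt_equivariant[OF orthogonal_transformation_matrix_vector_mult[OF assms]])

text \<open>A nonzero determinant keeps each column out of the span of the others, in particular of
  its predecessors, so the resulting columns are orthonormal.\<close>

lemma gs_matrix_in_orth_group:
  fixes X :: "real^'n^'n"
  assumes f: "bij_betw f {..<CARD('n)} (UNIV :: 'n set)" and det: "det X \<noteq> 0"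
  shows "gs_matrix f X \<in> orth_group"
proof -
  let ?n = "CARD('n)" and ?x = "\<lambda>k. column (f k) X"
  define g where "g = inv_into {..<?n} f"
  have inj: "inj_on f {..<?n}" using f by (simp add: bij_betw_def)
  have g_lt: "g c < ?n" and fg: "f (g c) = c" for c
    using f bij_betw_inv_into_right[OF f, of c] inv_into_into[of c f "{..<?n}"]
    by (auto simp: g_def bij_betw_def)
  have indep: "?x j \<notin> span (?x ` {..<j})" if "j < ?n" for j
  proof -
    have "?x ` {..<j} \<subseteq> {column i X |i. i \<noteq> f j}"
      using inj that by (auto simp: inj_on_def) (metis lessThan_iff less_trans nat_neq_iff)
    then show ?thesis
      using column_not_in_span[OF det, of "f j"] span_mono by blast
  qed
  have on: "norm (gram_schmidt ?x k) = 1 \<and> (\<forall>l<k. gram_schmidt ?x l \<bullet> gram_schmidt ?x k = 0)"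
    if "k < ?n" for k
    by (rule gram_schmidt_orthonormal[of ?n ?x, OF indep that])
  have "gram_schmidt ?x (g a) \<bullet> gram_schmidt ?x (g b) = 0" if "a \<noteq> b" for a b
  proof -
    have "g a \<noteq> g b" using that fg by metis
    then show ?thesis
      using on[OF g_lt[of a]] on[OF g_lt[of b]] by (metis inner_commute linorder_neqE_nat)
  qed
  then show ?thesis
    using on g_lt
    by (auto simp: orth_group_def orthogonal_matrix_orthonormal_columns column_gs_matrix
        orthogonal_def g_def[symmetric])
qed

lemma borel_measurable_matrixI:
  fixes h :: "'a \<Rightarrow> real^'n^'n"
  assumes "\<And>c. (\<lambda>w. column c (h w)) \<in> borel_measurable M"
  shows "h \<in> borel_measurable M"
proof -
  have "(\<lambda>w. h w $ r $ c) \<in> borel_measurable M" for r c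
    using borel_measurable_continuous_on[OF _ assms[of c], of "\<lambda>v. v $ r"]
    by (simp add: column_def continuous_on_component)
  then show ?thesis
    by (subst borel_measurable_euclidean_space) (auto simp: Basis_vec_def inner_axis)
qed

lemma continuous_on_column [continuous_intros]: "continuous_on S (\<lambda>X::real^'n^'n. column c X)"
  unfolding column_def by (intro continuous_intros)

lemma borel_measurable_gs_matrix: "(gs_matrix f :: real^'n^'n \<Rightarrow> _) \<in> borel_measurable borel"
proof (rule borel_measurable_matrixI)
  have "(\<lambda>X::real^'n^'n. column k X) \<in> borel_measurable borel" for k
    by (intro borel_measurable_continuous_onI continuous_intros)
  then show "(\<lambda>X::real^'n^'n. column c (gs_matrix f X)) \<in> borel_measurable borel" for c
    by (simp add: column_gs_matrix borel_measurable_gram_schmidt)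
qed

text \<open>Push the uniform distribution on the invertible matrices in the unit ball forward along
  Gram-Schmidt, which commutes with left multiplication by orthogonal matrices.\<close>

lemma left_haar_exists: "\<exists>mu :: (real^'n^'n) measure. left_haar mu"
proof -
  obtain f where f: "bij_betw f {..<CARD('n)} (UNIV :: 'n set)"
    using ex_bij_betw_nat_finite[of "UNIV :: 'n set"] by (auto simp: atLeast0LessThan)
  define S where "S = {X :: real^'n^'n. norm X < 1 \<and> det X \<noteq> 0}"
  \<comment> \<open>The default \<open>mat 1\<close> keeps \<open>phi\<close> inside the orthogonal
    group everywhere; the complement of \<open>S\<close> has mass zero under the uniform
    distribution.\<close>
  define phi where "phi X = (if X \<in> S then gs_matrix f X else mat 1)" for X :: "real^'n^'n"
  let ?R = "restrict_space borel (orth_group :: (real^'n^'n) set)"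
  let ?u = "uniform_measure lborel S"
  have "continuous_on UNIV (det :: real^'n^'n \<Rightarrow> real)"
    unfolding det_def by (intro continuous_intros)
  then have "open S"
    unfolding S_def by (intro open_Collect_conj open_Collect_less open_Collect_neq continuous_intros)
  then have Sb [measurable]: "S \<in> sets borel" by simp
  \<comment> \<open>Shrinks the identity to norm below 1 while its determinant
    \<open>c ^ CARD('n)\<close> stays nonzero; this shows that \<open>S\<close> is not
    empty.\<close>
  define c where "c = 1 / (norm (mat 1 :: real^'n^'n) + 1)"
  have c: "c > 0" "c * norm (mat 1 :: real^'n^'n) < 1"
    using norm_ge_zero[of "mat 1 :: real^'n^'n"]
    by (auto simp: c_def divide_less_eq_1 add_nonneg_pos)
  have "c *\<^sub>R mat 1 \<in> S"
  proof -
    have "c *\<^sub>R (mat 1 :: real^'n^'n) = mat c" by (simp add: vec_eq_iff mat_def)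
    moreover have "det (mat c :: real^'n^'n) = c ^ CARD('n)"
      by (subst det_diagonal) (auto simp: mat_def)
    ultimately have "det (c *\<^sub>R (mat 1 :: real^'n^'n)) \<noteq> 0" using c(1) by simp
    with c show ?thesis by (simp add: S_def)
  qed
  with \<open>open S\<close> have S0: "emeasure lborel S \<noteq> 0"
    by (intro emeasure_lborel_open_nonzero) auto
  have "emeasure lborel S \<le> emeasure lborel (ball 0 1 :: (real^'n^'n) set)"
    by (intro emeasure_mono) (auto simp: S_def)
  then have S1: "emeasure lborel S \<noteq> \<infinity>"
    using emeasure_lborel_ball_finite[of "0 :: real^'n^'n" 1] by (auto simp: top_unique)
  have pu: "prob_space ?u"
    using S0 S1 by (rule prob_space_uniform_measure)
  note [measurable] = borel_measurable_gs_matrix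
  have phi_O: "phi X \<in> orth_group" for X
    using gs_matrix_in_orth_group[OF f] by (auto simp: phi_def S_def orth_group_def orthogonal_matrix_id)
  have phi_b [measurable]: "phi \<in> borel_measurable borel"
    unfolding phi_def by measurable
  have phi_m: "phi \<in> measurable ?u ?R"
    by (rule measurable_restrict_space2) (auto simp: phi_O)
  define mu where "mu = distr ?u ?R phi"
  have sets_mu: "sets mu = sets ?R" by (simp add: mu_def)
  have space_mu: "space mu = orth_group" by (simp add: mu_def space_restrict_space)
  have em: "emeasure mu A = emeasure lborel (S \<inter> phi -` A) / emeasure lborel S" if "A \<in> sets mu" for A
  proof -
    have "A \<in> sets ?R" using that sets_mu by simp
    moreover from this have "phi -` A \<in> sets borel"
      using measurable_sets[OF phi_m] by simp
    ultimately show ?thesis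
      by (simp add: mu_def emeasure_distr[OF phi_m])
  qed
  have "distr mu mu (\<lambda>Q. U ** Q) = mu" if U: "U \<in> orth_group" for U
  proof (rule measure_eqI)
    show "sets (distr mu mu (\<lambda>Q. U ** Q)) = sets mu" by simp
    fix A assume "A \<in> sets (distr mu mu (\<lambda>Q. U ** Q))"
    then have A: "A \<in> sets mu" by simp
    have "(\<lambda>x. x) \<in> borel_measurable ?R"
      by (rule measurable_restrict_space1) simp
    then have [measurable]: "(\<lambda>x. x) \<in> borel_measurable mu"
      by (subst measurable_cong_sets[OF sets_mu refl])
    have "(\<lambda>Q. U ** Q) \<in> measurable mu ?R"
      by (rule measurable_restrict_space2) (auto simp: space_mu U orth_group_mult)
    then have m: "(\<lambda>Q. U ** Q) \<in> measurable mu mu"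
      by (subst measurable_cong_sets[OF refl sets_mu])
    have ot: "orthogonal_transformation (\<lambda>X::real^'n^'n. U ** X)"
      by (rule orthogonal_transformation_matrix_mult[OF U])
    have "det U \<noteq> 0"
      using U det_orthogonal_matrix by (force simp: orth_group_def)
    then have SU: "U ** X \<in> S \<longleftrightarrow> X \<in> S" for X
      using orthogonal_transformation_norm[OF ot] by (simp add: S_def det_mul)
    \<comment> \<open>On \<open>S\<close>, which is stable under multiplication by \<open>U\<close>,
      \<open>phi\<close> commutes with \<open>U\<close>. So invariance of \<open>mu\<close> reduces
      to invariance of Lebesgue measure under the isometry \<open>X\<close> to
      \<open>U ** X\<close>.\<close>
    have eq: "S \<inter> phi -` ((\<lambda>Q. U ** Q) -` A \<inter> space mu) = (\<lambda>X. U ** X) -` (S \<inter> phi -` A)"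
      using phi_O by (auto simp: space_mu) (auto simp: SU phi_def gs_matrix_equivariant[OF U])
    have "phi -` A \<in> sets borel"
      using measurable_sets[OF phi_m] A sets_mu by simp
    then have "S \<inter> phi -` A \<in> sets borel" by simp
    then have "emeasure lborel (S \<inter> phi -` ((\<lambda>Q. U ** Q) -` A \<inter> space mu)) = emeasure lborel (S \<inter> phi -` A)"
      unfolding eq by (rule emeasure_lborel_orthogonal_vimage[OF ot])
    then show "emeasure (distr mu mu (\<lambda>Q. U ** Q)) A = emeasure mu A"
      using measurable_sets[OF m A] by (simp add: emeasure_distr[OF m A] em A)
  qed
  moreover have "prob_space mu"
    unfolding mu_def by (rule prob_space.prob_space_distr[OF pu phi_m])
  ultimately have "left_haar mu"
    by (simp add: left_haar_def sets_mu space_mu)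
  then show ?thesis ..
qed

lemma left_haar_haar_O: "left_haar haar_O"
  unfolding haar_O_eq_The
  using left_haar_exists left_haar_unique by (metis theI)

section \<open>Moments of random projections\<close>

text \<open>The notation \<open>real^'n\<close> pins \<open>'n\<close> to the class \<open>finite\<close> and cannot be combined with
  \<open>linorder\<close>.\<close>

type_synonym 'n rvec = "(real, 'n) vec"
type_synonym 'n sqmat = "((real, 'n) vec, 'n) vec"

lemma prob_space_haar_O: "prob_space haar_O"
  and space_haar_O: "space haar_O = orth_group"
  and distr_haar_O: "U \<in> orth_group \<Longrightarrow> distr haar_O haar_O (\<lambda>Q. U ** Q) = haar_O"
  using left_haar_haar_O by (auto simp: left_haar_def)

section \<open>The induced measure on projections\<close>

lemma projection_measurable [measurable]:
  "(\<lambda>Q. Q ** I_MN M ** transpose Q) \<in> borel_measurable haar_O"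
proof -
  note [measurable] = left_haar_ident_borel[OF left_haar_haar_O]
  show ?thesis by measurable
qed

lemma sets_haar_A [measurable_cong]: "sets (haar_A M) = sets borel"
  by (simp add: haar_A_def)

lemma space_haar_A [simp]: "space (haar_A M) = UNIV"
  by (simp add: haar_A_def)

lemma prob_space_haar_A: "prob_space (haar_A M)"
  unfolding haar_A_def
  by (rule prob_space.prob_space_distr[OF prob_space_haar_O projection_measurable])

text \<open>Conjugating \<open>Q ** I_MN M ** transpose Q\<close> by \<open>U\<close> amounts to
  replacing \<open>Q\<close> by \<open>U ** Q\<close>, so left invariance of \<open>haar_O\<close>
  carries over.\<close>

lemma distr_haar_A_conj:
  assumes U: "U \<in> orth_group"
  shows "distr (haar_A M) borel (\<lambda>A. U ** A ** transpose U) = haar_A M"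
proof -
  note [measurable] = left_haar_ident_borel[OF left_haar_haar_O]
  have m: "(\<lambda>Q. U ** Q) \<in> measurable haar_O haar_O"
    by (rule left_haar_measurable_into[OF left_haar_haar_O])
      (auto simp: space_haar_O U orth_group_mult)
  have c: "(\<lambda>A. U ** A ** transpose U) \<in> borel_measurable borel" by measurable
  have "distr (haar_A M) borel (\<lambda>A. U ** A ** transpose U)
      = distr haar_O borel ((\<lambda>A. U ** A ** transpose U) \<circ> (\<lambda>Q. Q ** I_MN M ** transpose Q))"
    unfolding haar_A_def by (rule distr_distr[OF c projection_measurable])
  also have "(\<lambda>A. U ** A ** transpose U) \<circ> (\<lambda>Q. Q ** I_MN M ** transpose Q)
      = (\<lambda>Q. Q ** I_MN M ** transpose Q) \<circ> (\<lambda>Q. U ** Q)"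
    by (simp add: fun_eq_iff matrix_transpose_mul matrix_mul_assoc)
  also have "distr haar_O borel ((\<lambda>Q. Q ** I_MN M ** transpose Q) \<circ> (\<lambda>Q. U ** Q))
      = distr (distr haar_O haar_O (\<lambda>Q. U ** Q)) borel (\<lambda>Q. Q ** I_MN M ** transpose Q)"
    by (rule distr_distr[OF projection_measurable m, symmetric])
  finally show ?thesis by (simp add: distr_haar_O[OF U] haar_A_def)
qed

text \<open>\<open>haar_A\<close> is a measure on all matrices, so properties of projections enter
  as almost-everywhere statements.\<close>

lemma AE_haar_A:
  assumes "Measurable.pred borel P" "\<And>Q. Q \<in> orth_group \<Longrightarrow> P (Q ** I_MN M ** transpose Q)"
  shows "AE A in haar_A M. P A"
proof -
  have "{A \<in> space borel. P A} \<in> sets borel" using assms(1) by (rule predE)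
  then show ?thesis
    unfolding haar_A_def using assms(2)
    by (subst AE_distr_iff[OF projection_measurable]) (auto simp: space_haar_O)
qed

text \<open>A continuous function is bounded on the image of the compact group, hence almost
  everywhere.\<close>

lemma integrable_haar_A:
  fixes f :: "'n::{finite,linorder} sqmat \<Rightarrow> real"
  assumes f: "continuous_on UNIV f"
  shows "integrable (haar_A M) f"
proof -
  interpret prob_space "haar_A M :: ('n sqmat) measure" by (rule prob_space_haar_A)
  have [measurable]: "f \<in> borel_measurable borel"
    using f by (rule borel_measurable_continuous_onI)
  have "compact ((\<lambda>Q::'n sqmat. f (Q ** I_MN M ** transpose Q)) ` orth_group)"
    by (intro compact_continuous_image compact_orth_group continuous_on_compose2[OF f]
        continuous_intros) auto
  then obtain B where "\<And>Q::'n sqmat. Q \<in> orth_group \<Longrightarrow> norm (f (Q ** I_MN M ** transpose Q)) \<le> B"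
    using compact_imp_bounded by (force simp: bounded_iff)
  then have "AE A in haar_A M. norm (f A) \<le> B"
    by (intro AE_haar_A) auto
  then show ?thesis by (rule integrable_const_bound) measurable
qed

section \<open>Symmetry, idempotence and trace\<close>

lemma transpose_I_MN: "transpose (I_MN M) = I_MN M"
  by (auto simp: I_MN_def transpose_def vec_eq_iff)

lemma I_MN_idem: "I_MN M ** I_MN M = I_MN M"
  by (auto simp: I_MN_def matrix_matrix_mult_def vec_eq_iff if_distrib[of "\<lambda>x. x * _"] sum.delta'
      intro!: sum.neutral cong: if_cong)

text \<open>The rank \<open>h\<close> in the linear order is a bijection onto the numbers below
  \<open>CARD('n)\<close>, so exactly \<open>M\<close> indices have rank below
  \<open>M\<close>.\<close>

lemma trace_I_MN:
  assumes "M \<le> CARD('n::{finite,linorder})"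
  shows "trace (I_MN M :: 'n sqmat) = real M"
proof -
  define h where "h r = card {j::'n. j < r}" for r
  have mono: "h r < h s" if "r < s" for r s
    unfolding h_def
    by (rule psubset_card_mono) (use that in \<open>auto intro: less_trans\<close>)
  have inj: "inj h"
    by (rule injI) (metis mono neqE less_irrefl)
  have "h r < CARD('n)" for r
    unfolding h_def by (intro psubset_card_mono) auto
  then have "h ` UNIV = {..<CARD('n)}"
    using inj by (intro card_subset_eq) (auto simp: card_image)
  then have "h ` {r. h r < M} = {..<M}"
    using assms by (auto simp: set_eq_iff image_iff) (metis less_le_trans)
  then have "card {r. h r < M} = M"
    using inj by (metis card_image card_lessThan inj_on_subset subset_UNIV)
  moreover have "trace (I_MN M :: 'n sqmat) = (\<Sum>r\<in>UNIV. if h r < M then 1 else 0)"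
    by (simp add: trace_def I_MN_def h_def)
  ultimately show ?thesis by (simp add: sum.If_cases)
qed

lemma AE_haar_A_sym: "AE A in haar_A M. \<forall>a b. A $ a $ b = A $ b $ a"
proof -
  have "AE A in haar_A M. transpose A = A"
    by (rule AE_haar_A) (auto simp: matrix_transpose_mul transpose_I_MN matrix_mul_assoc)
  then show ?thesis
    by eventually_elim (auto simp: transpose_def vec_eq_iff)
qed

lemma AE_haar_A_idem: "AE A in haar_A M. \<forall>a b. (\<Sum>v\<in>UNIV. A $ a $ v * A $ v $ b) = A $ a $ b"
proof -
  have "(Q ** I_MN M ** transpose Q) ** (Q ** I_MN M ** transpose Q) = Q ** I_MN M ** transpose Q"
    if "Q \<in> orth_group" for Q :: "'a sqmat"
  proof -
    have "(Q ** I_MN M ** transpose Q) ** (Q ** I_MN M ** transpose Q)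
        = Q ** I_MN M ** (transpose Q ** Q) ** I_MN M ** transpose Q"
      by (simp only: matrix_mul_assoc)
    also have "transpose Q ** Q = mat 1" using that by (simp add: orth_group_def orthogonal_matrix)
    also have "Q ** I_MN M ** mat 1 ** I_MN M ** transpose Q = Q ** (I_MN M ** I_MN M) ** transpose Q"
      by (simp only: matrix_mul_assoc matrix_mul_rid)
    finally show ?thesis by (simp add: I_MN_idem)
  qed
  then have "AE A in haar_A M. A ** A = (A :: 'a sqmat)"
    by (intro AE_haar_A) auto
  then show ?thesis
    by eventually_elim (auto simp: matrix_matrix_mult_def vec_eq_iff)
qed

lemma AE_haar_A_trace:
  assumes "M \<le> CARD('n::{finite,linorder})"
  shows "AE A in (haar_A M :: ('n sqmat) measure). (\<Sum>v\<in>UNIV. A $ v $ v) = real M"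
proof -
  have "trace (Q ** I_MN M ** transpose Q) = real M" if "Q \<in> orth_group" for Q :: "'n sqmat"
  proof -
    have "trace (Q ** I_MN M ** transpose Q) = trace (transpose Q ** Q ** I_MN M)"
      by (simp add: trace_mul_sym[of "Q ** I_MN M"] matrix_mul_assoc)
    also have "transpose Q ** Q = mat 1" using that by (simp add: orth_group_def orthogonal_matrix)
    finally show ?thesis by (simp add: trace_I_MN[OF assms])
  qed
  moreover have "(\<lambda>A::'n sqmat. \<Sum>v\<in>UNIV. A $ v $ v) \<in> borel_measurable borel"
    by (intro borel_measurable_continuous_onI continuous_intros)
  ultimately show ?thesis
    by (intro AE_haar_A) (auto simp: trace_def)
qed

section \<open>Moments as invariant multilinear forms\<close>

text \<open>Extends \<open>moment\<close> from basis vectors to arbitrary vectors, so that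
  orthogonal maps other than coordinate permutations can act on the arguments.\<close>

definition moment_form :: "nat \<Rightarrow> nat \<Rightarrow> (nat \<Rightarrow> 'n::{finite,linorder} rvec) \<Rightarrow> real" where
  "moment_form M k x = (\<integral>A. (\<Prod>j<k. x (2*j+1) \<bullet> (A *v x (2*j+2))) \<partial>haar_A M)"

definition moment :: "nat \<Rightarrow> nat \<Rightarrow> (nat \<Rightarrow> 'n::{finite,linorder}) \<Rightarrow> real" where
  "moment M k i = (\<integral>A. (\<Prod>j<k. A $ i (2*j+1) $ i (2*j+2)) \<partial>haar_A M)"

lemma moment_eq_form: "moment M k i = moment_form M k (\<lambda>p. axis (i p) 1)"
  by (simp add: moment_def moment_form_def matrix_vector_mult_basis inner_axis' column_def)

lemma integrable_moment:
  "integrable (haar_A M) (\<lambda>A. \<Prod>j<k. A $ i (2*j+1) $ i (2*j+2))"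
  by (intro integrable_haar_A continuous_intros)

lemma integrable_moment_form:
  "integrable (haar_A M) (\<lambda>A. \<Prod>j<k. x (2*j+1) \<bullet> (A *v x (2*j+2)))"
  unfolding matrix_vector_mult_def
  by (intro integrable_haar_A continuous_intros)

lemma moment_form_cong:
  assumes "\<And>p. p \<in> {1..2*k} \<Longrightarrow> x p = y p"
  shows "moment_form M k x = moment_form M k y"
  unfolding moment_form_def
  by (intro Bochner_Integration.integral_cong prod.cong refl arg_cong2[where f=inner]
      arg_cong2[where f="(*v)"] assms) auto

lemma moment_cong:
  assumes "\<And>p. p \<in> {1..2*k} \<Longrightarrow> i p = i' p"
  shows "moment M k i = moment M k i'"
  unfolding moment_eq_form by (rule moment_form_cong) (simp add: assms)

text \<open>Moving \<open>f\<close> from the vectors to the matrix conjugates \<open>A\<close> by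
  the transpose of \<open>V\<close>, which does not change its law.\<close>

lemma moment_form_orthogonal:
  fixes f :: "'n::{finite,linorder} rvec \<Rightarrow> 'n rvec"
  assumes f: "orthogonal_transformation f"
  shows "moment_form M k (\<lambda>p. f (x p)) = moment_form M k x"
proof -
  define V where "V = matrix f"
  have fV: "f v = V *v v" for v
    using f by (simp add: V_def matrix_works orthogonal_transformation_linear)
  have V: "V \<in> orth_group"
    using f by (simp add: V_def orth_group_def orthogonal_transformation_matrix)
  have adj: "(V *v a) \<bullet> b = a \<bullet> (transpose V *v b)" for a b
    by (metis dot_lmul_matrix vector_transpose_matrix)
  let ?c = "\<lambda>A. transpose V ** A ** transpose (transpose V)"
  let ?g = "\<lambda>A. \<Prod>j<k. x (2*j+1) \<bullet> (A *v x (2*j+2))"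
  have "(\<Prod>j<k. f (x (2*j+1)) \<bullet> (A *v f (x (2*j+2)))) = ?g (?c A)" for A
    unfolding fV adj by (simp add: matrix_vector_mul_assoc matrix_mul_assoc)
  then have "moment_form M k (\<lambda>p. f (x p)) = (\<integral>A. ?g (?c A) \<partial>haar_A M)"
    by (simp add: moment_form_def)
  also have "\<dots> = integral\<^sup>L (distr (haar_A M) borel ?c) ?g"
  proof (rule integral_distr[symmetric])
    show "?g \<in> borel_measurable borel"
      unfolding matrix_vector_mult_def
      by (intro borel_measurable_continuous_onI continuous_intros)
  qed measurable
  also have "\<dots> = moment_form M k x"
    by (simp only: distr_haar_A_conj[OF orth_group_transpose[OF V]] moment_form_def)
  finally show ?thesis .
qed

text \<open>Position \<open>p\<close> occurs in a single factor, the one with number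
  \<open>(p - 1) div 2\<close>, and in only one of its two slots.\<close>

lemma linear_moment_form_upd:
  assumes p: "p \<in> {1..2*k}"
  shows "linear (\<lambda>y. moment_form M k (x(p := y)))"
proof -
  define l where "l = (p - 1) div 2"
  have l: "l < k" "p = 2*l+1 \<or> p = 2*l+2"
    using p by (auto simp: l_def)
  define F where "F x A j = x (2*j+1) \<bullet> (A *v x (2*j+2))" for x :: "nat \<Rightarrow> 'a rvec" and A j
  have split: "(\<Prod>j<k. F (x(p:=y)) A j) = F (x(p:=y)) A l * (\<Prod>j\<in>{..<k}-{l}. F x A j)" for y A
  proof -
    have "(\<Prod>j<k. F (x(p:=y)) A j) = F (x(p:=y)) A l * (\<Prod>j\<in>{..<k}-{l}. F (x(p:=y)) A j)"
      using l by (intro prod.remove) auto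
    also have "(\<Prod>j\<in>{..<k}-{l}. F (x(p:=y)) A j) = (\<Prod>j\<in>{..<k}-{l}. F x A j)"
      using l by (intro prod.cong refl) (auto simp: F_def)
    finally show ?thesis .
  qed
  have add: "F (x(p:=y+z)) A l = F (x(p:=y)) A l + F (x(p:=z)) A l" for y z A
    using l(2) by (auto simp: F_def inner_add_left inner_add_right matrix_vector_right_distrib)
  have scale: "F (x(p:=c *\<^sub>R y)) A l = c * F (x(p:=y)) A l" for c y A
    using l(2) by (auto simp: F_def matrix_vector_mult_scaleR)
  have int: "integrable (haar_A M) (\<lambda>A. \<Prod>j<k. F x A j)" for x
    unfolding F_def by (rule integrable_moment_form)
  have eq: "moment_form M k x = (\<integral>A. (\<Prod>j<k. F x A j) \<partial>haar_A M)" for x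
    by (simp add: moment_form_def F_def)
  show ?thesis
  proof (rule linearI)
    fix y z
    have "moment_form M k (x(p:=y+z)) = (\<integral>A. (\<Prod>j<k. F (x(p:=y)) A j) + (\<Prod>j<k. F (x(p:=z)) A j) \<partial>haar_A M)"
      unfolding eq by (simp add: split add distrib_right)
    also have "\<dots> = moment_form M k (x(p:=y)) + moment_form M k (x(p:=z))"
      unfolding eq by (rule Bochner_Integration.integral_add[OF int int])
    finally show "moment_form M k (x(p:=y+z)) = moment_form M k (x(p:=y)) + moment_form M k (x(p:=z))" .
  next
    fix c y
    have "moment_form M k (x(p:=c *\<^sub>R y)) = (\<integral>A. c * (\<Prod>j<k. F (x(p:=y)) A j) \<partial>haar_A M)"
      unfolding eq by (simp add: split scale mult.assoc)
    then show "moment_form M k (x(p:=c *\<^sub>R y)) = c *\<^sub>R moment_form M k (x(p:=y))"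
      unfolding eq by simp
  qed
qed

text \<open>Relabelling the values is an orthogonal map; the inverse in \<open>f\<close> makes it
  send \<open>axis a 1\<close> to \<open>axis (\<pi> a) 1\<close>.\<close>

lemma moment_permute:
  assumes pi: "bij (\<pi> :: 'n \<Rightarrow> 'n::{finite,linorder})"
  shows "moment M k (\<lambda>p. \<pi> (i p)) = moment M k i"
proof -
  define f :: "'n rvec \<Rightarrow> 'n rvec" where "f x = (\<chi> a. x $ inv \<pi> a)" for x
  have "linear f" by (rule linearI) (auto simp: f_def vec_eq_iff)
  moreover have "f x \<bullet> f y = x \<bullet> y" for x y
    unfolding f_def inner_vec_def
    using sum.reindex_bij_betw[OF bij_imp_bij_inv[OF pi], of "\<lambda>a. x $ a \<bullet> y $ a"] by simp
  ultimately have f: "orthogonal_transformation f" by (simp add: orthogonal_transformation_def)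
  have "f (axis a 1) = axis (\<pi> a) 1" for a
    using bij_inv_eq_iff[OF pi] by (simp add: f_def axis_def vec_eq_iff) metis
  then show ?thesis
    using moment_form_orthogonal[OF f, of M k "\<lambda>p. axis (i p) 1"]
    by (simp add: moment_eq_form)
qed

section \<open>Reflections and an index that occurs four times\<close>

text \<open>Reflection in the hyperplane orthogonal to \<open>w\<close>; for \<open>w = 0\<close>
  division by zero makes it the identity.\<close>

definition householder :: "'a::real_inner \<Rightarrow> 'a \<Rightarrow> 'a" where
  "householder w x = x - (2 * (w \<bullet> x) / (w \<bullet> w)) *\<^sub>R w"

lemma orthogonal_transformation_householder: "orthogonal_transformation (householder w)"
proof (cases "w = 0")
  case True
  then show ?thesis by (simp add: householder_def[abs_def] orthogonal_transformation_def linear_id[unfolded id_def])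
next
  case False
  have "linear (householder w)"
    by (rule linearI) (simp_all add: householder_def inner_add_right add_divide_distrib algebra_simps)
  moreover have "householder w x \<bullet> householder w y = x \<bullet> y" for x y
    using False by (simp add: householder_def inner_diff_left inner_diff_right inner_commute[of x w] field_simps)
  ultimately show ?thesis by (simp add: orthogonal_transformation_def)
qed

text \<open>The reflection \<open>f1\<close> kills the terms of odd degree in \<open>v\<close>; comparing coefficients in the
  expansion along \<open>f3\<close>, where \<open>(-3/5)\<^sup>2 + (4/5)\<^sup>2 = 1\<close>, leaves the three pairings.\<close>

lemma quadrilinear_invariant:
  fixes G :: "'v::real_vector \<Rightarrow> 'v \<Rightarrow> 'v \<Rightarrow> 'v \<Rightarrow> real"
  assumes lin: "\<And>b c d. linear (\<lambda>a. G a b c d)" "\<And>a c d. linear (\<lambda>b. G a b c d)"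
    "\<And>a b d. linear (\<lambda>c. G a b c d)" "\<And>a b c. linear (\<lambda>d. G a b c d)"
    and inv: "\<And>f a b c d. f \<in> {f1, f2, f3} \<Longrightarrow> G (f a) (f b) (f c) (f d) = G a b c d"
    and f: "f1 u = u" "f1 v = - v" "f2 u = v" "f2 v = u" "f3 u = (-3/5) *\<^sub>R u + (4/5) *\<^sub>R v"
  shows "G u u u u = G u u v v + G u v u v + G u v v u"
proof -
  note ex = lin[THEN linear_add] lin[THEN linear_diff] lin[THEN linear_cmul] lin[THEN linear_neg]
  have odd: "G u u u v = 0" "G u u v u = 0" "G u v u u = 0" "G v u u u = 0"
    "G u v v v = 0" "G v u v v = 0" "G v v u v = 0" "G v v v u = 0"
    using inv[of f1 u u u v] inv[of f1 u u v u] inv[of f1 u v u u] inv[of f1 v u u u]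
      inv[of f1 u v v v] inv[of f1 v u v v] inv[of f1 v v u v] inv[of f1 v v v u]
    by (simp_all add: f ex)
  have swap: "G v v v v = G u u u u" "G v v u u = G u u v v" "G v u v u = G u v u v" "G v u u v = G u v v u"
    using inv[of f2 u u u u] inv[of f2 u u v v] inv[of f2 u v u v] inv[of f2 u v v u]
    by (simp_all add: f)
  \<comment> \<open>After \<open>odd\<close> and \<open>swap\<close>, \<open>G u u u u\<close> has
    coefficient 81/625 + 256/625 = 337/625 and the three pairings have 288/625; these add up to
    1.\<close>
  show ?thesis
    using inv[of f3 u u u u] by (simp add: f ex odd swap) (simp add: field_simps)
qed

lemma moment_four_fold:
  fixes i :: "nat \<Rightarrow> 'n::{finite,linorder}"
  assumes pos: "{p, q, r, s} \<subseteq> {1..2*k}" "distinct [p, q, r, s]"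
    and uv: "u \<noteq> v"
    and rest: "\<And>t. t \<in> {1..2*k} - {p, q, r, s} \<Longrightarrow> i t \<noteq> u \<and> i t \<noteq> v"
  shows "moment M k (i(p:=u, q:=u, r:=u, s:=u)) =
      moment M k (i(p:=u, q:=u, r:=v, s:=v)) +
      moment M k (i(p:=u, q:=v, r:=u, s:=v)) +
      moment M k (i(p:=u, q:=v, r:=v, s:=u))"
proof -
  define e :: "'n \<Rightarrow> 'n rvec" where "e a = axis a 1" for a
  define x where "x t = e (i t)" for t
  define G where "G a b c d = moment_form M k (x(p:=a, q:=b, r:=c, s:=d))" for a b c d
  have mG: "moment M k (i(p:=a, q:=b, r:=c, s:=d)) = G (e a) (e b) (e c) (e d)" for a b c d
    unfolding moment_eq_form G_def e_def by (rule moment_form_cong) (simp add: x_def e_def)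
  have ee: "e a \<bullet> e b = (if a = b then 1 else 0)" for a b
    by (simp add: e_def inner_axis_axis)
  \<comment> \<open>The three reflections negate \<open>e v\<close>, exchange \<open>e u\<close>
    with \<open>e v\<close>, and send \<open>e u\<close> to
    \<open>(-3/5) *\<^sub>R e u + (4/5) *\<^sub>R e v\<close>. All fix the other basis vectors,
    hence by \<open>rest\<close> the arguments at the remaining positions.\<close>
  let ?ws = "{e v, e u - e v, 2 *\<^sub>R e u - e v}"
  have inv: "G (f a) (f b) (f c) (f d) = G a b c d" if w: "f \<in> householder ` ?ws" for f a b c d
  proof -
    have f: "orthogonal_transformation f"
      using w orthogonal_transformation_householder by auto
    have "f (x t) = x t" if "t \<in> {1..2*k} - {p, q, r, s}" for t
      using rest[OF that] w by (auto simp: householder_def x_def ee inner_diff_left)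
    then have "G (f a) (f b) (f c) (f d) = moment_form M k (\<lambda>t. f ((x(p:=a, q:=b, r:=c, s:=d)) t))"
      unfolding G_def by (intro moment_form_cong) auto
    also have "\<dots> = G a b c d"
      unfolding G_def by (rule moment_form_orthogonal[OF f])
    finally show ?thesis .
  qed
  \<comment> \<open>Linearity is available for the outermost update only, so each slot in turn is
    brought there; the positions are distinct.\<close>
  have upd: "x(p:=a, q:=b, r:=c, s:=d) = x(q:=b, r:=c, s:=d, p:=a)"
    "x(p:=a, q:=b, r:=c, s:=d) = x(p:=a, r:=c, s:=d, q:=b)"
    "x(p:=a, q:=b, r:=c, s:=d) = x(p:=a, q:=b, s:=d, r:=c)" for a b c d
    using pos(2) by (auto simp: fun_eq_iff)
  have lin1: "linear (\<lambda>a. G a b c d)" for b c d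
    unfolding G_def upd(1) by (rule linear_moment_form_upd) (use pos(1) in simp)
  have lin2: "linear (\<lambda>b. G a b c d)" for a c d
    unfolding G_def upd(2) by (rule linear_moment_form_upd) (use pos(1) in simp)
  have lin3: "linear (\<lambda>c. G a b c d)" for a b d
    unfolding G_def upd(3) by (rule linear_moment_form_upd) (use pos(1) in simp)
  have lin4: "linear (\<lambda>d. G a b c d)" for a b c
    unfolding G_def by (rule linear_moment_form_upd) (use pos(1) in simp)
  have "G (e u) (e u) (e u) (e u) = G (e u) (e u) (e v) (e v) + G (e u) (e v) (e u) (e v) + G (e u) (e v) (e v) (e u)"
  proof (rule quadrilinear_invariant[OF lin1 lin2 lin3 lin4])
    show "G (f a) (f b) (f c) (f d) = G a b c d"
      if "f \<in> {householder (e v), householder (e u - e v), householder (2 *\<^sub>R e u - e v)}" for f a b c d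
      by (rule inv) (use that in auto)
    show "householder (2 *\<^sub>R e u - e v) (e u) = (-3/5) *\<^sub>R e u + (4/5) *\<^sub>R e v"
      using uv by (simp add: householder_def ee inner_diff_left inner_diff_right vec_eq_iff algebra_simps)
    show "householder (e v) (e u) = e u" "householder (e v) (e v) = - e v"
      "householder (e u - e v) (e u) = e v" "householder (e u - e v) (e v) = e u"
      using uv by (simp_all add: householder_def ee inner_diff_left inner_diff_right vec_eq_iff)
  qed
  then show ?thesis by (simp only: mG)
qed

section \<open>Pair partitions and the recursion\<close>

lemma transp_ab_involution [simp]: "transp_ab a b (transp_ab a b x) = x"
  by (simp add: transp_ab_def)

lemma transp_ab_mem:
  "a \<in> S \<Longrightarrow> b \<in> S \<Longrightarrow> x \<in> S \<Longrightarrow> transp_ab a b x \<in> S"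
  by (simp add: transp_ab_def)

lemma pair_in_perm_act_transp_ab:
  "{x, y} \<in> perm_act (transp_ab a b) m \<longleftrightarrow> {transp_ab a b x, transp_ab a b y} \<in> m"
proof
  assume "{x, y} \<in> perm_act (transp_ab a b) m"
  then obtain B where B: "B \<in> m" "{x, y} = transp_ab a b ` B" by (auto simp: perm_act_def)
  have "transp_ab a b ` {x, y} = B" unfolding B(2) by (simp add: image_image)
  then have "{transp_ab a b x, transp_ab a b y} = B" by simp
  with B(1) show "{transp_ab a b x, transp_ab a b y} \<in> m" by metis
next
  assume "{transp_ab a b x, transp_ab a b y} \<in> m"
  then have "transp_ab a b ` {transp_ab a b x, transp_ab a b y} \<in> perm_act (transp_ab a b) m"
    unfolding perm_act_def by (rule imageI)
  then show "{x, y} \<in> perm_act (transp_ab a b) m" by simp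
qed

text \<open>A transposition is its own inverse, so composing with it transports the index function
  along the action on pair partitions.\<close>

lemma strongly_admissible_transp_ab:
  assumes i: "strongly_admissible k m i" and ab: "a \<in> {1..2*k}" "b \<in> {1..2*k}"
  shows "strongly_admissible k (perm_act (transp_ab a b) m) (\<lambda>x. i (transp_ab a b x))"
  unfolding strongly_admissible_def pair_in_perm_act_transp_ab
proof (intro ballI impI)
  fix x y assume *: "x \<in> {1..2*k}" "y \<in> {1..2*k}" "x \<noteq> y"
  then have "transp_ab a b x \<noteq> transp_ab a b y" by (metis transp_ab_involution)
  with i * show "({transp_ab a b x, transp_ab a b y} \<in> m) = (i (transp_ab a b x) = i (transp_ab a b y))"
    using transp_ab_mem[OF ab] unfolding strongly_admissible_def by blast
qed

lemma pair_partitionsD: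
  assumes "m \<in> pair_partitions k" "{a, b} \<in> m"
  shows "a \<noteq> b" "a \<in> {1..2*k}" "b \<in> {1..2*k}"
proof -
  have "card {a, b} = 2" "{a, b} \<subseteq> {1..2*k}" using assms by (auto simp: pair_partitions_def)
  then show "a \<noteq> b" "a \<in> {1..2*k}" "b \<in> {1..2*k}" by auto
qed

lemma pair_partitions_partner_unique:
  assumes "m \<in> pair_partitions k" "{a, b} \<in> m" "{a, c} \<in> m"
  shows "b = c"
proof -
  have disj: "B \<inter> B' = {}" if "B \<in> m" "B' \<in> m" "B \<noteq> B'" for B B'
    using assms(1) that by (simp add: pair_partitions_def)
  have "{a, b} = {a, c}"
    by (rule ccontr) (use disj[OF assms(2,3)] in auto)
  then show ?thesis by (auto simp: doubleton_eq_iff)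
qed

lemma pair_partitions_partner:
  assumes m: "m \<in> pair_partitions k" and "a \<in> {1..2*k}"
  obtains b where "{a, b} \<in> m"
proof -
  have "a \<in> \<Union>m" using assms by (simp add: pair_partitions_def)
  then obtain B where B: "B \<in> m" "a \<in> B" by blast
  then have "card B = 2" using m by (simp add: pair_partitions_def)
  then obtain x y where "B = {x, y}" by (auto simp: card_2_iff)
  with B that show ?thesis by (auto simp: insert_commute)
qed

lemma card_pair_partition:
  assumes m: "m \<in> pair_partitions k"
  shows "finite m" "card m = k"
proof -
  have U: "\<Union>m = {1..2*k}" and c: "\<And>b. b \<in> m \<Longrightarrow> card b = 2"
    and d: "pairwise disjnt m"
    using m by (auto simp: pair_partitions_def pairwise_def disjnt_def)
  show "finite m" using U by (metis finite_UnionD finite_atLeastAtMost)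
  have "card (\<Union>m) = sum card m"
    using d c by (intro card_Union_disjoint) (auto intro: card_ge_0_finite)
  with U c show "card m = k" by simp
qed

section \<open>Strongly admissible index functions\<close>

text \<open>Give the \<open>k\<close> blocks distinct values; \<open>B a\<close> is the block of
  \<open>a\<close>.\<close>

lemma strongly_admissible_exists:
  assumes m: "m \<in> pair_partitions k" and k: "k \<le> CARD('n::finite)"
  shows "\<exists>i :: nat \<Rightarrow> 'n. strongly_admissible k m i"
proof -
  obtain f :: "nat set \<Rightarrow> 'n" where f: "inj_on f m"
    using card_le_inj[of m "UNIV :: 'n set"] card_pair_partition[OF m] k by auto
  define B where "B a = (THE b. b \<in> m \<and> a \<in> b)" for a
  have B: "B a = b" if "b \<in> m" "a \<in> b" for a b
    unfolding B_def using that m by (intro the_equality) (simp, unfold pair_partitions_def, blast)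
  have Bm: "B a \<in> m \<and> a \<in> B a" if "a \<in> {1..2*k}" for a
  proof -
    have "a \<in> \<Union>m" using m that by (simp add: pair_partitions_def)
    then obtain b where "b \<in> m" "a \<in> b" by blast
    then show ?thesis using B by metis
  qed
  have "{a, b} \<in> m \<longleftrightarrow> f (B a) = f (B b)" if ab: "a \<in> {1..2*k}" "b \<in> {1..2*k}" "a \<noteq> b" for a b
  proof
    assume "{a, b} \<in> m"
    then show "f (B a) = f (B b)" using B by (metis insertI1 insertI2)
  next
    assume "f (B a) = f (B b)"
    then have eq: "B a = B b" using f Bm ab by (auto dest: inj_onD)
    have "card (B a) = 2" using m Bm[OF ab(1)] by (simp add: pair_partitions_def)
    moreover have "a \<in> B a" "b \<in> B a" using Bm ab eq by auto
    ultimately have "B a = {a, b}" using ab(3) by (auto simp: card_2_iff)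
    then show "{a, b} \<in> m" using Bm ab by metis
  qed
  then have "strongly_admissible k m (\<lambda>a. f (B a))" unfolding strongly_admissible_def by blast
  then show ?thesis by blast
qed

lemma bij_extend_finite:
  fixes h :: "'n::finite \<Rightarrow> 'n"
  assumes "inj_on h S"
  obtains g where "bij g" "\<And>x. x \<in> S \<Longrightarrow> g x = h x"
proof -
  have "card (- S) = card (- (h ` S))"
    by (simp add: card_image[OF assms] Compl_eq_Diff_UNIV card_Diff_subset)
  then obtain g where g: "bij_betw g (- S) (- (h ` S))"
    using finite_same_card_bij[of "- S" "- (h ` S)"] by auto
  define p where "p x = (if x \<in> S then h x else g x)" for x
  have "bij_betw p S (h ` S)"
    using assms by (subst bij_betw_cong[of S p h]) (auto simp: p_def bij_betw_def)
  moreover have "bij_betw p (- S) (- (h ` S))"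
    using g by (subst bij_betw_cong[of "- S" p g]) (auto simp: p_def)
  ultimately have "bij_betw p (S \<union> - S) (h ` S \<union> - (h ` S))"
    by (rule bij_betw_combine) auto
  then have "bij p" by simp
  then show ?thesis using that[of p] by (simp add: p_def)
qed

text \<open>Both functions have the same level sets, so one arises from the other by an injection on
  values, which extends to a permutation. This makes the choice by \<open>SOME\<close> in
  \<open>WgA\<close> harmless.\<close>

lemma moment_strongly_admissible_eq:
  fixes i i' :: "nat \<Rightarrow> 'n::{finite,linorder}"
  assumes "strongly_admissible k m i" "strongly_admissible k m i'"
  shows "moment M k i = moment M k i'"
proof -
  let ?D = "{1..2*k}"
  have eq: "i a = i b \<longleftrightarrow> i' a = i' b" if "a \<in> ?D" "b \<in> ?D" for a b
    using assms that unfolding strongly_admissible_def by (cases "a = b") blast+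
  define h where "h v = i' (inv_into ?D i v)" for v
  have hi: "h (i a) = i' a" if "a \<in> ?D" for a
    unfolding h_def using eq[of "inv_into ?D i (i a)" a] that
    by (metis f_inv_into_f image_eqI inv_into_into)
  have "inj_on h (i ` ?D)"
    by (rule inj_onI) (auto simp: hi eq)
  then obtain g where g: "bij g" "\<And>x. x \<in> i ` ?D \<Longrightarrow> g x = h x" by (rule bij_extend_finite) blast
  have "moment M k i' = moment M k (\<lambda>p. g (i p))"
    by (rule moment_cong) (simp add: g(2) hi)
  then show ?thesis using moment_permute[OF g(1)] by simp
qed

lemma WgA_eq_moment:
  fixes i :: "nat \<Rightarrow> 'n::{finite,linorder}"
  assumes i: "strongly_admissible k m i"
  shows "WgA TYPE('n) M k m = moment M k i"
proof (cases "k = 0")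
  case True
  interpret prob_space "haar_A M :: 'n sqmat measure" by (rule prob_space_haar_A)
  show ?thesis using True prob_space by (simp add: WgA_def moment_def)
next
  case False
  have "strongly_admissible k m (SOME i :: nat \<Rightarrow> 'n. strongly_admissible k m i)"
    using someI[of "strongly_admissible k m" i] i by simp
  from moment_strongly_admissible_eq[OF this i] False show ?thesis
    by (simp add: WgA_def moment_def Let_def)
qed

section \<open>Summation over the common value of a block\<close>

text \<open>Only the last factor, \<open>A $ v $ v\<close>, depends on \<open>v\<close>, and it sums
  to the trace.\<close>

lemma sum_moment_trace:
  fixes i :: "nat \<Rightarrow> 'n::{finite,linorder}"
  assumes M: "M \<le> CARD('n)"
  shows "(\<Sum>v\<in>UNIV. moment M (Suc n) (i(2*n+1 := v, 2*n+2 := v))) = real M * moment M n i"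
proof -
  let ?i = "\<lambda>v. i(2*n+1 := v, 2*n+2 := v)"
  have "(\<Sum>v\<in>UNIV. moment M (Suc n) (?i v))
      = (\<integral>A. (\<Sum>v\<in>UNIV. \<Prod>j<Suc n. A $ ?i v (2*j+1) $ ?i v (2*j+2)) \<partial>haar_A M)"
    unfolding moment_def by (intro Bochner_Integration.integral_sum[symmetric] integrable_moment)
  also have "\<dots> = (\<integral>A. real M * (\<Prod>j<n. A $ i (2*j+1) $ i (2*j+2)) \<partial>haar_A M)"
  proof (rule integral_cong_AE)
    show "AE A in haar_A M. (\<Sum>v\<in>UNIV. \<Prod>j<Suc n. A $ ?i v (2*j+1) $ ?i v (2*j+2))
        = real M * (\<Prod>j<n. A $ i (2*j+1) $ i (2*j+2))"
      using AE_haar_A_trace[OF M]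
    proof eventually_elim
      case (elim A)
      have "(\<Prod>j<Suc n. A $ ?i v (2*j+1) $ ?i v (2*j+2)) = A $ v $ v * (\<Prod>j<n. A $ i (2*j+1) $ i (2*j+2))" for v
        by simp
      then show ?case by (simp only: sum_distrib_right[symmetric] elim)
    qed
  qed (intro borel_measurable_integrable integrable_haar_A continuous_intros)+
  also have "\<dots> = real M * moment M n i" by (simp add: moment_def)
  finally show ?thesis .
qed

text \<open>By symmetry and idempotence the last factor and the factor containing \<open>b\<close>
  contract to one entry, in which the value at position \<open>2*n+2\<close> takes the place of that
  at \<open>b\<close>.\<close>

lemma sum_moment_square:
  fixes i :: "nat \<Rightarrow> 'n::{finite,linorder}"
  assumes b: "b \<in> {1..2*n}"
  shows "(\<Sum>v\<in>UNIV. moment M (Suc n) (i(2*n+1 := v, b := v))) = moment M n (i(b := i (2*n+2)))"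
proof -
  \<comment> \<open>\<open>l\<close> is the number, counted from 0, of the factor containing
    position \<open>b\<close>, and \<open>c\<close> is the other position of that factor.\<close>
  define l where "l = (b - 1) div 2"
  define c where "c = (if b = 2*l+1 then 2*l+2 else 2*l+1)"
  have l: "l < n" "b = 2*l+1 \<or> b = 2*l+2" using b by (auto simp: l_def)
  define z where "z = i (2*n+2)"
  let ?i = "\<lambda>v. i(2*n+1 := v, b := v)"
  \<comment> \<open>The auxiliary \<open>i'\<close> allows two uses: with position
    \<open>2*n+1\<close> already changed, and with \<open>i\<close> itself.\<close>
  have split: "(\<Prod>j<n. A $ (i'(b:=v)) (2*j+1) $ (i'(b:=v)) (2*j+2))
      = A $ v $ i c * (\<Prod>j\<in>{..<n}-{l}. A $ i (2*j+1) $ i (2*j+2))"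
    if sym: "\<forall>a b. A $ a $ b = A $ b $ a" and i': "\<And>p. p \<in> {1..2*n} \<Longrightarrow> i' p = i p" for A :: "'n sqmat" and v i'
  proof -
    have "(\<Prod>j<n. A $ (i'(b:=v)) (2*j+1) $ (i'(b:=v)) (2*j+2))
      = A $ (i'(b:=v)) (2*l+1) $ (i'(b:=v)) (2*l+2)
        * (\<Prod>j\<in>{..<n}-{l}. A $ (i'(b:=v)) (2*j+1) $ (i'(b:=v)) (2*j+2))"
      using l by (intro prod.remove) auto
    also have "(\<Prod>j\<in>{..<n}-{l}. A $ (i'(b:=v)) (2*j+1) $ (i'(b:=v)) (2*j+2))
        = (\<Prod>j\<in>{..<n}-{l}. A $ i (2*j+1) $ i (2*j+2))"
      using l by (intro prod.cong refl) (auto simp: i')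
    also have "A $ (i'(b:=v)) (2*l+1) $ (i'(b:=v)) (2*l+2) = A $ v $ i c"
      using l sym by (auto simp: c_def i')
    finally show ?thesis .
  qed
  have "(\<Sum>v\<in>UNIV. moment M (Suc n) (?i v))
      = (\<integral>A. (\<Sum>v\<in>UNIV. \<Prod>j<Suc n. A $ ?i v (2*j+1) $ ?i v (2*j+2)) \<partial>haar_A M)"
    unfolding moment_def by (intro Bochner_Integration.integral_sum[symmetric] integrable_moment)
  also have "\<dots> = (\<integral>A. (\<Prod>j<n. A $ (i(b := z)) (2*j+1) $ (i(b := z)) (2*j+2)) \<partial>haar_A M)"
  proof (rule integral_cong_AE)
    show "AE A in haar_A M. (\<Sum>v\<in>UNIV. \<Prod>j<Suc n. A $ ?i v (2*j+1) $ ?i v (2*j+2))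
        = (\<Prod>j<n. A $ (i(b := z)) (2*j+1) $ (i(b := z)) (2*j+2))"
      using AE_haar_A_sym AE_haar_A_idem
    proof eventually_elim
      case (elim A)
      let ?P = "\<Prod>j\<in>{..<n}-{l}. A $ i (2*j+1) $ i (2*j+2)"
      have "(\<Prod>j<Suc n. A $ ?i v (2*j+1) $ ?i v (2*j+2)) = (A $ z $ v * A $ v $ i c) * ?P" for v
      proof -
        have "(\<Prod>j<n. A $ ?i v (2*j+1) $ ?i v (2*j+2)) = A $ v $ i c * ?P"
          by (rule split[OF elim(1)]) auto
        moreover have "A $ ?i v (2*n+1) $ ?i v (2*n+2) = A $ z $ v"
          using b elim(1) by (auto simp: z_def)
        ultimately show ?thesis by simp
      qed
      then have "(\<Sum>v\<in>UNIV. \<Prod>j<Suc n. A $ ?i v (2*j+1) $ ?i v (2*j+2)) = A $ z $ i c * ?P"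
        using elim(2) by (simp only: sum_distrib_right[symmetric])
      then show ?case using split[OF elim(1), of i z] by simp
    qed
  qed (intro borel_measurable_integrable integrable_haar_A continuous_intros)+
  finally show ?thesis by (simp add: moment_def z_def)
qed

lemma moment_swap_last:
  "moment M (Suc n) (\<lambda>x. i (transp_ab (2*n+2) (2*n+1) x)) = moment M (Suc n) i"
  unfolding moment_def
proof (rule integral_cong_AE)
  let ?i = "\<lambda>x. i (transp_ab (2*n+2) (2*n+1) x)"
  show "AE A in haar_A M. (\<Prod>j<Suc n. A $ ?i (2*j+1) $ ?i (2*j+2)) = (\<Prod>j<Suc n. A $ i (2*j+1) $ i (2*j+2))"
    using AE_haar_A_sym
  proof eventually_elim
    case (elim A)
    have "(\<Prod>j<n. A $ ?i (2*j+1) $ ?i (2*j+2)) = (\<Prod>j<n. A $ i (2*j+1) $ i (2*j+2))"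
      by (intro prod.cong refl) (auto simp: transp_ab_def)
    moreover have "A $ ?i (2*n+1) $ ?i (2*n+2) = A $ i (2*n+1) $ i (2*n+2)"
      using elim by (auto simp: transp_ab_def)
    ultimately show ?case by simp
  qed
qed (intro borel_measurable_integrable integrable_haar_A continuous_intros)+

text \<open>The sum is empty if \<open>v\<close> is not taken outside \<open>{p, b}\<close>, and
  otherwise has two terms, from the block with value \<open>v\<close>. In the latter case
  \<open>i b\<close> is the free index for the four-fold identity.\<close>

lemma moment_merge_block:
  fixes i :: "nat \<Rightarrow> 'n::{finite,linorder}"
  assumes m: "m \<in> pair_partitions k" and i: "strongly_admissible k m i" and pb: "{p, b} \<in> m"
  shows "moment M k (i(p := v, b := v)) = moment M k i
      + (\<Sum>x\<in>{x \<in> {1..2*k} - {p, b}. i x = v}. moment M k (\<lambda>t. i (transp_ab x p t)))"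
proof -
  let ?D = "{1..2*k}"
  note pbD = pair_partitionsD[OF m pb]
  have adm: "{a, c} \<in> m \<longleftrightarrow> i a = i c" if "a \<in> ?D" "c \<in> ?D" "a \<noteq> c" for a c
    using i that unfolding strongly_admissible_def by blast
  have ipb: "i p = i b" using adm pbD pb by blast
  have other: "i x \<noteq> i b" "{p, x} \<notin> m" "{b, x} \<notin> m" if "x \<in> ?D - {p, b}" for x
  proof -
    have pb': "{b, p} \<in> m" using pb by (simp add: insert_commute)
    show "{p, x} \<notin> m" using pair_partitions_partner_unique[OF m pb, of x] that by auto
    show *: "{b, x} \<notin> m" using pair_partitions_partner_unique[OF m pb', of x] that by auto
    show "i x \<noteq> i b" using adm[of b x] * that pbD by auto
  qed
  show ?thesis
  proof (cases "\<exists>x \<in> ?D - {p, b}. i x = v")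
    case False
    have "strongly_admissible k m (i(p := v, b := v))"
      unfolding strongly_admissible_def
    proof (intro ballI impI)
      fix a c assume ac: "a \<in> ?D" "c \<in> ?D" "a \<noteq> c"
      consider "a \<in> {p, b}" "c \<in> {p, b}" | "a \<in> {p, b}" "c \<notin> {p, b}"
        | "a \<notin> {p, b}" "c \<in> {p, b}" | "a \<notin> {p, b}" "c \<notin> {p, b}" by blast
      then show "({a, c} \<in> m) = ((i(p := v, b := v)) a = (i(p := v, b := v)) c)"
      proof cases
        case 1
        then show ?thesis using ac pb by (auto simp: insert_commute)
      next
        case 2
        then show ?thesis using ac other[of c] False by auto
      next
        case 3
        then show ?thesis using ac other[of a] False by (auto simp: insert_commute)
      next
        case 4
        then show ?thesis using ac adm[of a c] by auto
      qed
    qed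
    from moment_strongly_admissible_eq[OF this i]
    have "moment M k (i(p := v, b := v)) = moment M k i" .
    moreover have fib: "{x \<in> ?D - {p, b}. i x = v} = {}" using False by auto
    ultimately show ?thesis unfolding fib by simp
  next
    case True
    then obtain x where x: "x \<in> ?D - {p, b}" "i x = v" by blast
    obtain y where xy: "{x, y} \<in> m" using pair_partitions_partner[OF m, of x] x by auto
    note xyD = pair_partitionsD[OF m xy]
    have iy: "i y = v" using adm[of x y] xyD xy x by auto
    have y: "y \<in> ?D - {p, b}"
      using xyD xy other[OF x(1)] by (auto simp: insert_commute)
    have fib: "{t \<in> ?D - {p, b}. i t = v} = {x, y}"
    proof -
      have "t = y" if "t \<in> ?D" "i t = v" "t \<noteq> x" for t
        using adm[of x t] that x pair_partitions_partner_unique[OF m xy, of t] by auto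
      then show ?thesis using x y iy by auto
    qed
    have d: "distinct [x, y, p, b]" using x y xyD pbD by auto
    have vb: "v \<noteq> i b" using other(1)[OF x(1)] x by auto
    have four: "moment M k (i(x:=v, y:=v, p:=v, b:=v)) =
        moment M k (i(x:=v, y:=v, p:=i b, b:=i b)) +
        moment M k (i(x:=v, y:=i b, p:=v, b:=i b)) +
        moment M k (i(x:=v, y:=i b, p:=i b, b:=v))"
    proof (rule moment_four_fold[OF _ d vb])
      show "{x, y, p, b} \<subseteq> ?D" using x y pbD by auto
      fix t assume t: "t \<in> ?D - {x, y, p, b}"
      then have "t \<notin> {t \<in> ?D - {p, b}. i t = v}" unfolding fib by auto
      then show "i t \<noteq> v \<and> i t \<noteq> i b" using t other(1)[of t] by auto
    qed
    have 1: "i(x:=v, y:=v, p:=v, b:=v) = i(p:=v, b:=v)"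
      "i(x:=v, y:=v, p:=i b, b:=i b) = i"
      "i(x:=v, y:=i b, p:=v, b:=i b) = (\<lambda>t. i (transp_ab y p t))"
      using x iy ipb d by (auto simp: fun_eq_iff transp_ab_def)
    \<comment> \<open>This pairing equals \<open>i\<close> after the transposition of
      \<open>x\<close> and \<open>p\<close> only up to exchanging the values \<open>v\<close> and
      \<open>i b\<close>, which is what \<open>\<pi>\<close> does.\<close>
    have 2: "moment M k (i(x:=v, y:=i b, p:=i b, b:=v)) = moment M k (\<lambda>t. i (transp_ab x p t))"
    proof -
      define \<pi> where "\<pi> w = (if w = v then i b else if w = i b then v else w)" for w
      have "bij \<pi>" by (rule o_bij[of \<pi>]) (auto simp: \<pi>_def fun_eq_iff)
      moreover have "moment M k (i(x:=v, y:=i b, p:=i b, b:=v)) = moment M k (\<lambda>t. \<pi> (i (transp_ab x p t)))"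
      proof (rule moment_cong)
        fix t assume t: "t \<in> ?D"
        show "(i(x:=v, y:=i b, p:=i b, b:=v)) t = \<pi> (i (transp_ab x p t))"
        proof (cases "t \<in> {x, y, p, b}")
          case True
          then show ?thesis using x iy ipb d vb by (auto simp: transp_ab_def \<pi>_def)
        next
          case False
          then have "t \<notin> {t \<in> ?D - {p, b}. i t = v}" unfolding fib by auto
          then show ?thesis using False t other(1)[of t] by (auto simp: transp_ab_def \<pi>_def)
        qed
      qed
      ultimately show ?thesis using moment_permute by metis
    qed
    show ?thesis
      unfolding fib using four xyD(1) by (simp add: 1 2)
  qed
qed

text \<open>Each position \<open>x\<close> outside the block contributes exactly once, at
  \<open>v = i x\<close>.\<close>

lemma sum_moment_merge_block:
  fixes i :: "nat \<Rightarrow> 'n::{finite,linorder}"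
  assumes "m \<in> pair_partitions k" "strongly_admissible k m i" "{p, b} \<in> m"
  shows "(\<Sum>v\<in>UNIV. moment M k (i(p := v, b := v))) = real CARD('n) * moment M k i
      + (\<Sum>x\<in>{1..2*k} - {p, b}. moment M k (\<lambda>t. i (transp_ab x p t)))"
proof -
  have "(\<Sum>v\<in>UNIV. \<Sum>x\<in>{x \<in> {1..2*k} - {p, b}. i x = v}. moment M k (\<lambda>t. i (transp_ab x p t)))
      = (\<Sum>x\<in>{1..2*k} - {p, b}. moment M k (\<lambda>t. i (transp_ab x p t)))"
    by (rule sum.group) auto
  then show ?thesis
    by (simp add: moment_merge_block[OF assms] sum.distrib)
qed

section \<open>Assembly of the recursion\<close>

lemma strongly_admissible_down:
  assumes "strongly_admissible (Suc n) m i"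
  shows "strongly_admissible n (down (Suc n) m) i"
proof -
  have "{a, b} \<in> down (Suc n) m \<longleftrightarrow> {a, b} \<in> m" if "a \<in> {1..2*n}" "b \<in> {1..2*n}" for a b
    using that by (auto simp: down_def doubleton_eq_iff)
  then show ?thesis using assms unfolding strongly_admissible_def by auto
qed

lemma strongly_admissible_cong:
  assumes "strongly_admissible k m i"
    and "\<And>a b. a \<in> {1..2*k} \<Longrightarrow> b \<in> {1..2*k} \<Longrightarrow> i a = i b \<longleftrightarrow> j a = j b"
  shows "strongly_admissible k m j"
  using assms unfolding strongly_admissible_def by simp

theorem mainTheorem2:
  fixes M k :: nat and m :: "nat set set"
  defines "N \<equiv> CARD('n::{finite,linorder})"
  assumes "0 < M" and "M < N" and "1 \<le> k" and "k \<le> N"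
    and "m \<in> pair_partitions k"
  shows "WgA TYPE('n) M k m =
      - (1 / real N) * (\<Sum>i=1..2*k-2. WgA TYPE('n) M k (perm_act (transp_ab i (2*k-1)) m))
      + (real M / real N) * (if {2*k-1, 2*k} \<in> m then WgA TYPE('n) M (k-1) (down k m) else 0)
      + (1 / real N) * (\<Sum>i=1..2*k-2. (if {i, 2*k} \<in> m
            then WgA TYPE('n) M (k-1) (down k (perm_act (transp_ab i (2*k-1)) m)) else 0))"
proof -
  obtain n where k: "k = Suc n" using \<open>1 \<le> k\<close> by (cases k) auto
  have pz: "2*k-1 = 2*n+1" "2*k = 2*n+2" "2*k-2 = 2*n" "k - 1 = n" by (auto simp: k)
  define p where "p = 2*n+1"
  define z where "z = 2*n+2"
  have pD: "p \<in> {1..2*k}" "z \<in> {1..2*k}" "p \<noteq> z" by (auto simp: p_def z_def k)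
  note m = \<open>m \<in> pair_partitions k\<close>
  obtain i :: "nat \<Rightarrow> 'n" where i: "strongly_admissible k m i"
    using strongly_admissible_exists[OF m] \<open>k \<le> N\<close> by (auto simp: N_def)
  define W where "W x = moment M k (\<lambda>t. i (transp_ab x p t))" for x
  have W: "WgA TYPE('n) M k (perm_act (transp_ab x p) m) = W x" if "x \<in> {1..2*k}" for x
    unfolding W_def by (rule WgA_eq_moment[OF strongly_admissible_transp_ab[OF i that pD(1)]])
  have sumW: "(\<Sum>x=1..2*n. WgA TYPE('n) M k (perm_act (transp_ab x p) m)) = sum W {1..2*n}"
    by (intro sum.cong refl W) (auto simp: k)
  have Wm: "WgA TYPE('n) M k m = moment M k i" by (rule WgA_eq_moment[OF i])
  have N0: "real N > 0" using \<open>M < N\<close> by simp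
  define X where "X = (if {p, z} \<in> m then WgA TYPE('n) M n (down k m) else 0)"
  define Y where "Y = (\<Sum>x=1..2*n. if {x, z} \<in> m
            then WgA TYPE('n) M n (down k (perm_act (transp_ab x p) m)) else 0)"
  \<comment> \<open>\<open>R\<close> collects the terms of order \<open>k - 1\<close>, multiplied by
    \<open>N\<close>; the next claim is the recursion with denominators cleared.\<close>
  define R where "R = real M * X + Y"
  have "real N * moment M k i + sum W {1..2*n} = R"
  proof (cases "{p, z} \<in> m")
    case True
    \<comment> \<open>The partner of \<open>z\<close> is \<open>p\<close>, so every term of
      \<open>Y\<close> vanishes.\<close>
    have "{x, z} \<notin> m" if "x \<in> {1..2*n}" for x
      using pair_partitions_partner_unique[OF m, of z x p] True that
      by (auto simp: insert_commute p_def)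
    then have R: "R = real M * moment M n i"
      using True i WgA_eq_moment[OF strongly_admissible_down, of n m i] by (simp add: R_def X_def Y_def k)
    have D: "{1..2*k} - {p, z} = {1..2*n}" by (auto simp: p_def z_def k)
    have "(\<Sum>v\<in>UNIV. moment M k (i(p := v, z := v))) = real M * moment M n i"
      using sum_moment_trace[of M n i] \<open>M < N\<close> by (simp add: p_def z_def k N_def)
    with sum_moment_merge_block[OF m i True, of M] show ?thesis
      unfolding R D W_def N_def by simp
  next
    case False
    obtain b where pb: "{p, b} \<in> m" using pair_partitions_partner[OF m pD(1)] .
    obtain a where za: "{z, a} \<in> m" using pair_partitions_partner[OF m pD(2)] .
    note pbD = pair_partitionsD[OF m pb] and zaD = pair_partitionsD[OF m za]
    have b: "b \<in> {1..2*n}" and bz: "b \<noteq> z"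
      using pbD False pb by (auto simp: p_def z_def k le_Suc_eq)
    have a: "a \<in> {1..2*n}" and ap: "a \<noteq> p"
      using zaD False za by (auto simp: p_def z_def k le_Suc_eq insert_commute)
    have adm: "{x, y} \<in> m \<longleftrightarrow> i x = i y" if "x \<in> {1..2*k}" "y \<in> {1..2*k}" "x \<noteq> y" for x y
      using i that unfolding strongly_admissible_def by blast
    have ipb: "i p = i b" and iza: "i z = i a" using adm pbD zaD pb za by blast+
    have ab: "a \<noteq> b"
      using pair_partitions_partner_unique[OF m, of a z p] pb za pD(3) by (auto simp: insert_commute)
    have xz: "{x, z} \<in> m \<longleftrightarrow> x = a" for x
      using pair_partitions_partner_unique[OF m za, of x] za by (auto simp: insert_commute)
    have ne: "i t \<noteq> i a" "i t \<noteq> i b" if "t \<in> {1..2*n}" "t \<noteq> a" "t \<noteq> b" for t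
    proof -
      have t: "t \<in> {1..2*k}" "t \<noteq> p" "t \<noteq> z" using that by (auto simp: p_def z_def k)
      show "i t \<noteq> i a" using adm[of t z] xz[of t] t that pD iza by auto
      show "i t \<noteq> i b" using adm[of p t] pair_partitions_partner_unique[OF m pb, of t] t that pD ipb by auto
    qed
    have iab: "i a \<noteq> i b" using adm[of z p] False iza ipb pD by (auto simp: insert_commute)
    \<comment> \<open>Only the term of the partner \<open>a\<close> of \<open>z\<close> survives in
      \<open>R\<close>. Its permuted partition contains \<open>{p, z}\<close> and joins
      \<open>a\<close> to \<open>b\<close>; giving \<open>b\<close> the value
      \<open>i z = i a\<close> has the same level sets on the first \<open>2*n\<close>
      positions.\<close>
    have "strongly_admissible n (down k (perm_act (transp_ab a p) m)) (\<lambda>t. i (transp_ab a p t))"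
      using strongly_admissible_down[of n] strongly_admissible_transp_ab[OF i zaD(3) pD(1)] k by simp
    then have "strongly_admissible n (down k (perm_act (transp_ab a p) m)) (i(b := i z))"
    proof (rule strongly_admissible_cong)
      fix x y assume xy: "x \<in> {1..2*n}" "y \<in> {1..2*n}"
      have tr: "i (transp_ab a p t) = (if t = a then i b else i t)" if "t \<in> {1..2*n}" for t
        using that ipb by (auto simp: transp_ab_def p_def)
      show "i (transp_ab a p x) = i (transp_ab a p y) \<longleftrightarrow> (i(b := i z)) x = (i(b := i z)) y"
        unfolding tr[OF xy(1)] tr[OF xy(2)] using ne[OF xy(1)] ne[OF xy(2)] ab iab iza
        by (auto split: if_splits; metis)
    qed
    from WgA_eq_moment[OF this]
    have "R = moment M n (i(b := i z))"
      using False a by (simp add: R_def X_def Y_def xz)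
    also have "\<dots> = (\<Sum>v\<in>UNIV. moment M k (i(p := v, b := v)))"
      using sum_moment_square[OF b, of M i] by (simp add: p_def z_def k)
    also have "\<dots> = real N * moment M k i + sum W ({1..2*k} - {p, b})"
      using sum_moment_merge_block[OF m i pb, of M] by (simp add: W_def N_def)
    \<comment> \<open>The sum runs over \<open>z\<close> but omits \<open>b\<close>. Both terms
      equal \<open>moment M k i\<close>: for \<open>z\<close> by symmetry of the last factor, for
      \<open>b\<close> because \<open>i p = i b\<close>. Exchanging them gives the range
      \<open>{1..2*n}\<close>.\<close>
    also have "{1..2*k} - {p, b} = insert z ({1..2*n} - {b})"
      using bz by (auto simp: p_def z_def k)
    also have "sum W (insert z ({1..2*n} - {b})) = W z + sum W ({1..2*n} - {b})"
      by (rule sum.insert) (auto simp: z_def)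
    also have "W z = W b"
    proof -
      have "W z = moment M k i"
        using moment_swap_last[of M n i] by (simp add: W_def p_def z_def k)
      moreover have "W b = moment M k i"
        unfolding W_def by (rule moment_cong) (simp add: transp_ab_def ipb)
      ultimately show ?thesis by simp
    qed
    also have "W b + sum W ({1..2*n} - {b}) = sum W {1..2*n}"
      by (rule sum.remove[symmetric]) (use b in auto)
    finally show ?thesis by simp
  qed
  then have "moment M k i = - (1 / real N) * sum W {1..2*n} + (1 / real N) * R"
    using N0 by (simp add: field_simps)
  then show ?thesis
    unfolding pz(1,3,4) unfolding pz(2) p_def[symmetric] z_def[symmetric] Wm sumW R_def X_def[symmetric] Y_def[symmetric]
    by (simp add: algebra_simps)
qed

end
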